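(* Let $R,T\ge1$ and let $\mathbf{W}=\sum_{r=1}^{R}\mathbf{W}_r$, where $\mathbf{W}_1,\dots,\mathbf{W}_R$ are independent $T\times T$ complex Wishart matrices, each with one degree of freedom, $\mathbf{W}_r$ having diagonal covariance matrix $\mathbf{\Sigma}_r$. For every $n\ge1$ write the $n$-th order matrix-valued cumulant of $\mathbf{W}$ as $$\mathbf{K}_n[\mathbf{W}]=\sum_{r=1}^{R}\mathbf{K}_n[\mathbf{W}_r]+\mathbf{\Theta}_n,$$ where $\mathbf{\Theta}_n$ is the residual matrix. Then $\mathbf{\Theta}_1=\mathbf{\Theta}_2=\mathbf{0}_{T\times T}$ and $$\mathbf{\Theta}_3=\sum_{1\le i<j\le R}\Big(\mathrm{Tr}(\mathbf{\Sigma}_i\mathbf{\Sigma}_j)\,\mathbf{\Sigma}_i-\mathrm{Tr}(\mathbf{\Sigma}_i)\,\mathbf{\Sigma}_i\mathbf{\Sigma}_j\Big)+\sum_{1\le i<j\le R}\Big(\mathrm{Tr}(\mathbf{\Sigma}_i\mathbf{\Sigma}_j)\,\mathbf{\Sigma}_j-\mathrm{Tr}(\mathbf{\Sigma}_j)\,\mathbf{\Sigma}_i\mathbf{\Sigma}_j\Big).$$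
   Context: A $T\times T$ complex Wishart matrix with one degree of freedom and diagonal covariance $\mathbf{\Sigma}_r$ (a real diagonal matrix with nonnegative diagonal entries) is $\mathbf{W}_r=\mathbf{\Sigma}_r^{1/2}\mathbf{h}_r\mathbf{h}_r^{*}\mathbf{\Sigma}_r^{1/2}$, where $\mathbf{h}_r\in\mathbb{C}^{T}$ has i.i.d. zero-mean unit-variance circularly symmetric complex Gaussian entries and $^{*}$ is the conjugate transpose; the vectors $\mathbf{h}_1,\dots,\mathbf{h}_R$ are independent. For a random Hermitian $T\times T$ matrix $\mathbf{X}$ with all moments finite, $\mathbf{E}[\mathbf{X}^n]$ denotes the entrywise expectation of the matrix power $\mathbf{X}^n$. Put $\mathbf{\Phi}_{\mathbf{X}}(t)=\mathbf{E}[e^{\mathrm{i}t\mathbf{X}}]$ (matrix exponential) and, for real $t$ near $0$, $\mathbf{\Psi}_{\mathbf{X}}(t)=\log\mathbf{\Phi}_{\mathbf{X}}(t)$, where $\log\mathbf{A}=\sum_{k\ge1}(-1)^{k+1}(\mathbf{A}-\mathbf{I})^k/k$ is the matrix logarithm. The $n$-th order matrix-valued cumulant is $\mathbf{K}_n[\mathbf{X}]=\mathrm{i}^{-n}\,\frac{d^n}{dt^n}\mathbf{\Psi}_{\mathbf{X}}(t)\big|_{t=0}$. *)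

theory Defs
  imports "HOL-Probability.Probability"
begin

section \<open>Matrix functions\<close>

text \<open>
  The type class operations \<open>(*)\<close>, \<open>1\<close> and \<open>(^)\<close> on matrices are not the matrix operations, so
  \<open>exp\<close> and power series from the library do not apply to \<open>complex ^ 'n ^ 'n\<close>. The series
  below converge in the product topology, i.e. entrywise.
\<close>

primrec matpow :: "complex ^ 'n ^ 'n \<Rightarrow> nat \<Rightarrow> complex ^ 'n ^ 'n" where
  "matpow A 0 = mat 1"
| "matpow A (Suc k) = A ** matpow A k"

definition matexp :: "complex ^ 'n ^ 'n \<Rightarrow> complex ^ 'n ^ 'n" where
  "matexp A = (\<Sum>k. (1 / fact k) *\<^sub>R matpow A k)"

text \<open>The series starts at \<open>k = 1\<close>, hence the index shift.\<close>

definition matlog :: "complex ^ 'n ^ 'n \<Rightarrow> complex ^ 'n ^ 'n" where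
  "matlog A = (\<Sum>k. ((- 1) ^ k / real (Suc k)) *\<^sub>R matpow (A - mat 1) (Suc k))"

definition cscale :: "complex \<Rightarrow> complex ^ 'n ^ 'n \<Rightarrow> complex ^ 'n ^ 'n" where
  "cscale c A = map_matrix ((*) c) A"

definition cmatrix :: "real ^ 'n ^ 'n \<Rightarrow> complex ^ 'n ^ 'n" where
  "cmatrix A = map_matrix complex_of_real A"


section \<open>Matrix-valued cumulants\<close>

definition matexpectation :: "'a measure \<Rightarrow> ('a \<Rightarrow> complex ^ 'n ^ 'n) \<Rightarrow> complex ^ 'n ^ 'n" where
  "matexpectation M X = (\<chi> i j. integral\<^sup>L M (\<lambda>\<omega>. X \<omega> $ i $ j))"

definition mat_char :: "'a measure \<Rightarrow> ('a \<Rightarrow> complex ^ 'n ^ 'n) \<Rightarrow> real \<Rightarrow> complex ^ 'n ^ 'n" where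
  "mat_char M X t = matexpectation M (\<lambda>\<omega>. matexp (cscale (\<i> * complex_of_real t) (X \<omega>)))"

text \<open>
  Meaningful for \<open>t\<close> near \<open>0\<close>, where the logarithm series converges; only these values
  influence the derivatives at \<open>0\<close> used below.
\<close>

definition mat_log_char :: "'a measure \<Rightarrow> ('a \<Rightarrow> complex ^ 'n ^ 'n) \<Rightarrow> real \<Rightarrow> complex ^ 'n ^ 'n" where
  "mat_log_char M X t = matlog (mat_char M X t)"

definition higher_vector_deriv :: "nat \<Rightarrow> (real \<Rightarrow> 'b :: real_normed_vector) \<Rightarrow> real \<Rightarrow> 'b" where
  "higher_vector_deriv n f = ((\<lambda>g t. vector_derivative g (at t)) ^^ n) f"

definition mat_cumulant :: "'a measure \<Rightarrow> nat \<Rightarrow> ('a \<Rightarrow> complex ^ 'n ^ 'n) \<Rightarrow> complex ^ 'n ^ 'n" where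
  "mat_cumulant M n X = cscale (inverse (\<i> ^ n)) (higher_vector_deriv n (mat_log_char M X) 0)"


section \<open>Complex Wishart matrices with one degree of freedom\<close>

text \<open>
  Zero-mean, unit-variance and circularly symmetric: the real and imaginary parts are independent
  centred normal variables of variance \<open>1/2\<close> each (\<open>normal_density\<close> takes the standard deviation).
\<close>

definition std_complex_gaussian :: "'a measure \<Rightarrow> ('a \<Rightarrow> complex) \<Rightarrow> bool" where
  "std_complex_gaussian M Z \<longleftrightarrow>
     distributed M lborel (\<lambda>\<omega>. Re (Z \<omega>)) (normal_density 0 (sqrt (1 / 2))) \<and>
     distributed M lborel (\<lambda>\<omega>. Im (Z \<omega>)) (normal_density 0 (sqrt (1 / 2))) \<and>
     prob_space.indep_var M borel (\<lambda>\<omega>. Re (Z \<omega>)) borel (\<lambda>\<omega>. Im (Z \<omega>))"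

definition iid_complex_gaussian_vector :: "'a measure \<Rightarrow> ('a \<Rightarrow> complex ^ 'n) \<Rightarrow> bool" where
  "iid_complex_gaussian_vector M h \<longleftrightarrow>
     (\<forall>i. std_complex_gaussian M (\<lambda>\<omega>. h \<omega> $ i)) \<and>
     prob_space.indep_vars M (\<lambda>_. borel) (\<lambda>i \<omega>. h \<omega> $ i) UNIV"

definition diagonal_covariance :: "real ^ 'n ^ 'n \<Rightarrow> bool" where
  "diagonal_covariance S \<longleftrightarrow> (\<forall>i j. i \<noteq> j \<longrightarrow> S $ i $ j = 0) \<and> (\<forall>i. 0 \<le> S $ i $ i)"

text \<open>
  For a diagonal matrix with nonnegative entries the positive semidefinite square root is taken
  entry by entry on the diagonal.
\<close>

definition diag_sqrt :: "real ^ 'n ^ 'n \<Rightarrow> real ^ 'n ^ 'n" where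
  "diag_sqrt S = (\<chi> i j. if i = j then sqrt (S $ i $ i) else 0)"

lemma diagonal_covariance_diag_sqrt: "diagonal_covariance S \<Longrightarrow> diagonal_covariance (diag_sqrt S)"
  by (simp add: diagonal_covariance_def diag_sqrt_def)

lemma diag_sqrt_square:
  assumes "diagonal_covariance S"
  shows "diag_sqrt S ** diag_sqrt S = S"
proof -
  have "(diag_sqrt S ** diag_sqrt S) $ i $ j = S $ i $ j" for i j
  proof -
    have "(diag_sqrt S ** diag_sqrt S) $ i $ j =
        (\<Sum>k\<in>UNIV. if k = i then sqrt (S $ i $ i) * diag_sqrt S $ i $ j else 0)"
      unfolding matrix_matrix_mult_def vec_lambda_beta
      by (rule sum.cong) (simp_all add: diag_sqrt_def)
    also have "\<dots> = sqrt (S $ i $ i) * diag_sqrt S $ i $ j"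
      by simp
    also have "\<dots> = S $ i $ j"
      using assms by (simp add: diag_sqrt_def diagonal_covariance_def)
    finally show ?thesis .
  qed
  then show ?thesis
    by (simp add: vec_eq_iff)
qed

definition outer_self :: "complex ^ 'n \<Rightarrow> complex ^ 'n ^ 'n" where
  "outer_self v = (\<chi> i j. v $ i * cnj (v $ j))"

definition complex_wishart :: "real ^ 'n ^ 'n \<Rightarrow> ('a \<Rightarrow> complex ^ 'n) \<Rightarrow> 'a \<Rightarrow> complex ^ 'n ^ 'n" where
  "complex_wishart S h \<omega> = cmatrix (diag_sqrt S) ** outer_self (h \<omega>) ** cmatrix (diag_sqrt S)"

end

theory Submission
  imports Defs
begin

text \<open>
  Flipping the sign of one coordinate of all the Gaussian vectors preserves their joint law, so
  \<open>E exp (\<i> t W)\<close> is diagonal and its logarithm is taken entrywise: with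
  \<open>m\<^sub>k = E (W\<^sup>k)\<^sub>a\<^sub>a\<close> the cumulants are diagonal with entries \<open>m\<^sub>1\<close>, \<open>m\<^sub>2 - m\<^sub>1\<^sup>2\<close> and
  \<open>m\<^sub>3 - 3 m\<^sub>1 m\<^sub>2 + 2 m\<^sub>1\<^sup>3\<close>. Now split \<open>W = D + \<Sum>\<^sub>r V\<^sub>r\<close> into its diagonal mean \<open>D\<close> and centred
  independent summands. By independence the second and third moments of \<open>\<Sum>\<^sub>r V\<^sub>r\<close> are additive in \<open>r\<close>,
  and the only other contribution to the third cumulant is
  \<open>\<Sum>\<^sub>b (D\<^sub>b - D\<^sub>a) \<Sum>\<^sub>r E[(V\<^sub>r)\<^sub>a\<^sub>b (V\<^sub>r)\<^sub>b\<^sub>a]\<close>. It only involves \<open>b \<noteq> a\<close>, where the expectation is the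
  product of the two variances; the terms pairing different summands give the residual.
\<close>

section \<open>The matrix exponential along a line\<close>

lemma matpow_Suc_entry:
  "matpow X (Suc k) $ i $ j = (\<Sum>l\<in>UNIV. X $ i $ l * matpow X k $ l $ j)"
  by (simp add: matrix_matrix_mult_def)

lemma matpow_one: "matpow X (Suc 0) = X"
  by simp

lemma matpow_cscale_entry: "matpow (cscale c X) k $ i $ j = c ^ k * matpow X k $ i $ j"
proof (induction k arbitrary: i j)
  case 0
  then show ?case by simp
next
  case (Suc k)
  show ?case
    by (simp only: matpow_Suc_entry Suc)
      (simp add: cscale_def map_matrix_def sum_distrib_left mult_ac)
qed

text \<open>The sum of the moduli of all entries dominates every row sum, so each multiplication by
  \<open>X\<close> costs at most one such factor. The geometric bound makes the exponential series
  converge at every complex argument.\<close>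

lemma norm_matpow_entry_le:
  fixes X :: "complex ^ 'n ^ 'n"
  shows "norm (matpow X k $ i $ j) \<le> (\<Sum>a\<in>UNIV. \<Sum>b\<in>UNIV. norm (X $ a $ b)) ^ k"
proof (induction k arbitrary: i j)
  case 0
  then show ?case by (simp add: mat_def)
next
  case (Suc k)
  let ?C = "\<Sum>a\<in>UNIV. \<Sum>b\<in>UNIV. norm (X $ a $ b)"
  have "norm (matpow X (Suc k) $ i $ j) \<le> (\<Sum>l\<in>UNIV. norm (X $ i $ l) * ?C ^ k)"
    unfolding matpow_Suc_entry
    by (intro sum_norm_le) (simp add: norm_mult mult_left_mono Suc)
  also have "\<dots> = (\<Sum>l\<in>UNIV. norm (X $ i $ l)) * ?C ^ k"
    by (simp add: sum_distrib_right)
  also have "\<dots> \<le> ?C * ?C ^ k"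
    by (intro mult_right_mono member_le_sum zero_le_power sum_nonneg) auto
  finally show ?case by simp
qed

text \<open>Coefficients in \<open>z\<close> of one entry of exp(i z X). Treating each entry as a
  scalar power series opens the way to termwise differentiation.\<close>

definition expcoef :: "complex ^ 'n ^ 'n \<Rightarrow> 'n \<Rightarrow> 'n \<Rightarrow> nat \<Rightarrow> complex" where
  "expcoef X i j k = \<i> ^ k / fact k * matpow X k $ i $ j"

lemma summable_expcoef: "summable (\<lambda>k. expcoef X i j k * z ^ k)"
proof (rule summable_comparison_test')
  let ?C = "\<Sum>a\<in>UNIV. \<Sum>b\<in>UNIV. norm (X $ a $ b)"
  show "summable (\<lambda>k. (?C * norm z) ^ k /\<^sub>R fact k)"
    by (rule summable_exp_generic)
  show "norm (expcoef X i j k * z ^ k) \<le> (?C * norm z) ^ k /\<^sub>R fact k" for k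
    using mult_right_mono[OF norm_matpow_entry_le[of X k i j], of "norm z ^ k / fact k"]
    by (simp add: expcoef_def norm_mult norm_divide norm_power power_mult_distrib field_simps)
qed

definition exp_entry :: "complex ^ 'n ^ 'n \<Rightarrow> 'n \<Rightarrow> 'n \<Rightarrow> complex \<Rightarrow> complex" where
  "exp_entry X i j z = (\<Sum>k. expcoef X i j k * z ^ k)"

lemma sums_vec_iff: "(f sums (L :: 'a :: real_normed_vector ^ 'n)) \<longleftrightarrow> (\<forall>i. (\<lambda>k. f k $ i) sums (L $ i))"
proof
  assume "f sums L"
  then show "\<forall>i. (\<lambda>k. f k $ i) sums (L $ i)"
    using bounded_linear.sums[OF bounded_linear_vec_nth] by blast
next
  assume "\<forall>i. (\<lambda>k. f k $ i) sums (L $ i)"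
  then show "f sums L"
    unfolding sums_def by (intro vec_tendstoI) simp
qed

lemma matexp_entry: "matexp (cscale (\<i> * z) X) $ i $ j = exp_entry X i j z"
proof -
  have "(\<lambda>k. (1 / fact k) *\<^sub>R matpow (cscale (\<i> * z) X) k) sums (\<chi> i j. exp_entry X i j z)"
    unfolding sums_vec_iff
  proof (intro allI)
    fix i j
    have "(\<lambda>k. expcoef X i j k * z ^ k) sums exp_entry X i j z"
      unfolding exp_entry_def by (rule summable_sums[OF summable_expcoef])
    then show "(\<lambda>k. ((1 / fact k) *\<^sub>R matpow (cscale (\<i> * z) X) k) $ i $ j)
        sums ((\<chi> i j. exp_entry X i j z) $ i $ j)"
      by (simp only: vector_scaleR_component matpow_cscale_entry expcoef_def vec_lambda_beta)
        (simp add: scaleR_conv_of_real power_mult_distrib mult_ac)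
  qed
  then have "matexp (cscale (\<i> * z) X) = (\<chi> i j. exp_entry X i j z)"
    unfolding matexp_def by (rule sums_unique[symmetric])
  then show ?thesis
    by simp
qed

text \<open>The differential equation d/dz exp(i z X) = i X exp(i z X), read off at the level of
  coefficients: the factor Suc k from differentiation cancels against the factorial.\<close>

lemma diffs_expcoef: "diffs (expcoef X i j) k = \<i> * (\<Sum>l\<in>UNIV. X $ i $ l * expcoef X l j k)"
proof -
  have "diffs (expcoef X i j) k = \<i> ^ Suc k / fact k * matpow X (Suc k) $ i $ j"
    unfolding diffs_def expcoef_def by (simp del: of_nat_Suc matpow.simps)
  then show ?thesis
    unfolding matpow_Suc_entry by (simp add: expcoef_def sum_distrib_left sum_divide_distrib mult_ac)
qed

lemma exp_entry_deriv:
  "((\<lambda>z. exp_entry X i j z) has_field_derivative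
     \<i> * (\<Sum>l\<in>UNIV. X $ i $ l * exp_entry X l j z)) (at z)"
proof -
  have "(\<Sum>k. diffs (expcoef X i j) k * z ^ k) = \<i> * (\<Sum>l\<in>UNIV. X $ i $ l * exp_entry X l j z)"
  proof (rule sums_unique[symmetric])
    have "(\<lambda>k. \<i> * (\<Sum>l\<in>UNIV. X $ i $ l * (expcoef X l j k * z ^ k))) sums
        (\<i> * (\<Sum>l\<in>UNIV. X $ i $ l * exp_entry X l j z))"
      unfolding exp_entry_def
      by (intro sums_mult sums_sum summable_sums summable_expcoef)
    then show "(\<lambda>k. diffs (expcoef X i j) k * z ^ k) sums
        (\<i> * (\<Sum>l\<in>UNIV. X $ i $ l * exp_entry X l j z))"
      by (simp add: diffs_expcoef sum_distrib_left mult_ac)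
  qed
  with termdiffs_strong_converges_everywhere[OF summable_expcoef, of X i j z]
  show ?thesis
    by (simp add: exp_entry_def)
qed

lemma exp_entry_0: "exp_entry X i j 0 = (if i = j then 1 else 0)"
proof -
  have "(\<Sum>k. expcoef X i j k * 0 ^ k) = expcoef X i j 0"
    by (rule powser_zero)
  then show ?thesis
    by (simp add: exp_entry_def expcoef_def mat_def)
qed

lemma exp_entry_real_deriv:
  "((\<lambda>t. exp_entry X i j (complex_of_real t)) has_vector_derivative
     \<i> * (\<Sum>l\<in>UNIV. X $ i $ l * exp_entry X l j (complex_of_real t))) (at t)"
  using has_vector_derivative_real_field[OF exp_entry_deriv[of X i j "complex_of_real t"]]
  by blast

text \<open>For Hermitian \<open>X\<close> the columns of \<open>exp (\<i> t X)\<close> keep their norm, since the derivative of the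
  squared norm is twice the real part of \<open>\<i>\<close> times the real number \<open>v\<^sup>* X v\<close>.\<close>

lemma norm_exp_entry_le_1:
  assumes herm: "\<And>a b. X $ a $ b = cnj (X $ b $ a)"
  shows "norm (exp_entry X i j (complex_of_real t)) \<le> 1"
proof -
  define u where "u l s = exp_entry X l j (complex_of_real s)" for l s
  define N where "N s = (\<Sum>l\<in>UNIV. u l s * cnj (u l s))" for s
  have du: "(u l has_vector_derivative \<i> * (\<Sum>k\<in>UNIV. X $ l $ k * u k s)) (at s)" for l s
    unfolding u_def by (rule exp_entry_real_deriv)
  have dcu: "((\<lambda>s. cnj (u l s)) has_vector_derivative cnj (\<i> * (\<Sum>k\<in>UNIV. X $ l $ k * u k s))) (at s)" for l s
    by (rule bounded_linear.has_vector_derivative[OF bounded_linear_cnj du])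
  have "(N has_vector_derivative 0) (at s)" for s
  proof -
    have "(N has_vector_derivative (\<Sum>l\<in>UNIV. u l s * cnj (\<i> * (\<Sum>k\<in>UNIV. X $ l $ k * u k s)) +
        \<i> * (\<Sum>k\<in>UNIV. X $ l $ k * u k s) * cnj (u l s))) (at s)"
      unfolding N_def[abs_def]
      by (intro has_vector_derivative_sum has_vector_derivative_mult du dcu)
    \<comment> \<open>Conjugation turns \<i> into its negative and, by Hermitian symmetry,
      \<open>X $ l $ k\<close> into \<open>X $ k $ l\<close>; exchanging the two summation indices
      then matches the other half of the product rule.\<close>
    moreover have "(\<Sum>l\<in>UNIV. u l s * cnj (\<i> * (\<Sum>k\<in>UNIV. X $ l $ k * u k s))) =
        - (\<Sum>l\<in>UNIV. \<i> * (\<Sum>k\<in>UNIV. X $ l $ k * u k s) * cnj (u l s))"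
    proof -
      have "(\<Sum>l\<in>UNIV. u l s * cnj (\<i> * (\<Sum>k\<in>UNIV. X $ l $ k * u k s))) =
          (\<Sum>l\<in>UNIV. \<Sum>k\<in>UNIV. - \<i> * (X $ k $ l * u l s * cnj (u k s)))"
        by (simp add: sum_distrib_left sum_negf mult_ac flip: herm)
      also have "\<dots> = (\<Sum>k\<in>UNIV. \<Sum>l\<in>UNIV. - \<i> * (X $ k $ l * u l s * cnj (u k s)))"
        by (rule sum.swap)
      also have "\<dots> = - (\<Sum>l\<in>UNIV. \<i> * (\<Sum>k\<in>UNIV. X $ l $ k * u k s) * cnj (u l s))"
        by (simp add: sum_distrib_left sum_distrib_right sum_negf mult_ac)
      finally show ?thesis .
    qed
    ultimately show ?thesis
      by (simp only: sum.distrib left_minus)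
  qed
  then have "N t = N 0"
    by (metis has_vector_derivative_zero_constant convex_UNIV UNIV_I has_vector_derivative_at_within)
  moreover have "N 0 = 1"
    by (simp add: N_def u_def exp_entry_0 if_distrib cong: if_cong)
  moreover have "N s = of_real (\<Sum>l\<in>UNIV. (norm (u l s))\<^sup>2)" for s
    by (simp only: N_def complex_norm_square of_real_sum flip: of_real_power)
  ultimately have "(\<Sum>l\<in>UNIV. (norm (u l t))\<^sup>2) = 1"
    by (metis of_real_eq_1_iff)
  moreover have "(norm (u i t))\<^sup>2 \<le> (\<Sum>l\<in>UNIV. (norm (u l t))\<^sup>2)"
    by (rule member_le_sum) auto
  ultimately have "(norm (u i t))\<^sup>2 \<le> 1"
    by simp
  then show ?thesis
    unfolding u_def by (simp add: abs_square_le_1)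
qed

text \<open>The m-th derivative of the entry, namely the entry of (i X)^m exp(i z X). Keeping the
  exponential as a separate right factor lets its unit bound on the real line apply at every
  order.\<close>

definition exp_entry_derivs :: "nat \<Rightarrow> complex ^ 'n ^ 'n \<Rightarrow> 'n \<Rightarrow> 'n \<Rightarrow> complex \<Rightarrow> complex" where
  "exp_entry_derivs m X i j z = \<i> ^ m * (\<Sum>l\<in>UNIV. matpow X m $ i $ l * exp_entry X l j z)"

text \<open>\<open>matpow\<close> unfolds from the left, but differentiating X^m exp(i z X) inserts
  the new factor between the power and the exponential.\<close>

lemma matpow_Suc_entry_right:
  "matpow X (Suc k) $ i $ j = (\<Sum>l\<in>UNIV. matpow X k $ i $ l * X $ l $ j)"
proof -
  have "matpow X (Suc k) = matpow X k ** X"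
    by (induction k) (simp_all add: matrix_mul_assoc)
  then show ?thesis
    by (simp add: matrix_matrix_mult_def)
qed

lemma exp_entry_derivs_0: "exp_entry_derivs 0 X i j z = exp_entry X i j z"
  by (simp add: exp_entry_derivs_def mat_def if_distrib[of "\<lambda>c. c * _"] cong: if_cong)

lemma exp_entry_derivs_at_0: "exp_entry_derivs m X i j 0 = \<i> ^ m * matpow X m $ i $ j"
  by (simp add: exp_entry_derivs_def exp_entry_0 if_distrib cong: if_cong)

lemma exp_entry_derivs_deriv:
  "((\<lambda>t. exp_entry_derivs m X i j (complex_of_real t)) has_vector_derivative
     exp_entry_derivs (Suc m) X i j (complex_of_real t)) (at t)"
proof -
  have "exp_entry_derivs (Suc m) X i j z =
      \<i> ^ m * (\<Sum>l\<in>UNIV. matpow X m $ i $ l * (\<i> * (\<Sum>k\<in>UNIV. X $ l $ k * exp_entry X k j z)))" for z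
    unfolding exp_entry_derivs_def matpow_Suc_entry_right
    by (simp add: sum_distrib_left sum_distrib_right mult_ac) (rule sum.swap)
  then show ?thesis
    unfolding exp_entry_derivs_def[of m]
    by (auto intro!: has_vector_derivative_mult_right has_vector_derivative_sum exp_entry_real_deriv)
qed

text \<open>The bound is free of \<open>t\<close>, so it serves as the dominating function when
  differentiating under the expectation.\<close>

lemma norm_exp_entry_derivs_le:
  assumes "\<And>a b. X $ a $ b = cnj (X $ b $ a)"
  shows "norm (exp_entry_derivs m X i j (complex_of_real t)) \<le> (\<Sum>l\<in>UNIV. norm (matpow X m $ i $ l))"
proof -
  have "norm (exp_entry_derivs m X i j (complex_of_real t)) =
      norm (\<Sum>l\<in>UNIV. matpow X m $ i $ l * exp_entry X l j (complex_of_real t))"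
    by (simp add: exp_entry_derivs_def norm_mult norm_power)
  also have "\<dots> \<le> (\<Sum>l\<in>UNIV. norm (matpow X m $ i $ l))"
    using norm_exp_entry_le_1[OF assms]
    by (intro sum_norm_le) (simp add: norm_mult mult_left_le)
  finally show ?thesis .
qed

section \<open>Derivatives\<close>

text \<open>The difference quotient form allows limits to be taken componentwise for matrices and
  along sequences for dominated convergence.\<close>

lemma has_vector_derivative_at_iff:
  "(f has_vector_derivative f') (at t) \<longleftrightarrow> ((\<lambda>h. (f (t + h) - f t) /\<^sub>R h) \<longlongrightarrow> f') (at 0)"
proof -
  have "norm (f (t + h) - f t - h *\<^sub>R f') / norm h = norm ((f (t + h) - f t) /\<^sub>R h - f')" if "h \<noteq> 0" for h
  proof -
    have "(f (t + h) - f t) /\<^sub>R h - f' = (f (t + h) - f t - h *\<^sub>R f') /\<^sub>R h"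
      using that by (simp add: scaleR_diff_right)
    then show ?thesis
      by (simp add: divide_inverse mult.commute)
  qed
  then have "((\<lambda>h. norm (f (t + h) - f t - h *\<^sub>R f') / norm h) \<longlongrightarrow> 0) (at 0) \<longleftrightarrow>
      ((\<lambda>h. norm ((f (t + h) - f t) /\<^sub>R h - f')) \<longlongrightarrow> 0) (at 0)"
    by (intro tendsto_cong eventually_at_filter[THEN iffD2] always_eventually) auto
  then show ?thesis
    by (simp add: has_vector_derivative_def has_derivative_at bounded_linear_scaleR_left
        tendsto_norm_zero_iff LIM_zero_iff)
qed

lemma has_vector_derivative_vec:
  assumes "\<And>i. ((\<lambda>t. f t $ i) has_vector_derivative f' $ i) (at t)"
  shows "(f has_vector_derivative (f' :: 'a :: real_normed_vector ^ 'n)) (at t)"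
proof -
  have "((\<lambda>h. (f (t + h) - f t) /\<^sub>R h) \<longlongrightarrow> f') (at 0)"
  proof (rule vec_tendstoI)
    fix i
    show "((\<lambda>h. ((f (t + h) - f t) /\<^sub>R h) $ i) \<longlongrightarrow> f' $ i) (at 0)"
      using assms[of i] by (simp add: has_vector_derivative_at_iff)
  qed
  then show ?thesis
    by (simp add: has_vector_derivative_at_iff)
qed

text \<open>Each further \<open>vector_derivative\<close> depends on the previous one near the
  point, so the chain \<open>F\<close> has to be valid on an open set rather than at
  \<open>t\<close> alone.\<close>

lemma higher_vector_deriv_eq:
  assumes "open S"
    and "\<And>k t. k < n \<Longrightarrow> t \<in> S \<Longrightarrow> (F k has_vector_derivative F (Suc k) t) (at t)"
    and "\<And>t. t \<in> S \<Longrightarrow> f t = F 0 t"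
    and "t \<in> S"
  shows "higher_vector_deriv n f t = F n t"
  using assms(2,4)
proof (induction n arbitrary: t)
  case 0
  then show ?case using assms(3) by (simp add: higher_vector_deriv_def)
next
  case (Suc n)
  have eq: "higher_vector_deriv n f s = F n s" if "s \<in> S" for s
    using Suc.IH[OF _ that] Suc.prems(1) by simp
  have "higher_vector_deriv (Suc n) f t = vector_derivative (higher_vector_deriv n f) (at t)"
    by (simp add: higher_vector_deriv_def)
  also have "(higher_vector_deriv n f has_vector_derivative F (Suc n) t) (at t)"
    by (rule has_vector_derivative_transform_within_open[OF Suc.prems(1) assms(1)])
      (use Suc.prems(2) eq in auto)
  then have "vector_derivative (higher_vector_deriv n f) (at t) = F (Suc n) t"
    by (rule vector_derivative_at)
  finally show ?case .
qed

text \<open>Since \<open>g\<close> bounds the derivative at every parameter, the mean value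
  inequality bounds all difference quotients by \<open>g\<close>; dominated convergence along
  sequences tending to 0 does the rest.\<close>

lemma has_vector_derivative_integral:
  fixes f :: "real \<Rightarrow> 'a \<Rightarrow> 'b :: {banach, second_countable_topology}"
  assumes int: "\<And>t. integrable M (f t)"
    and meas: "f' t \<in> borel_measurable M"
    and deriv: "\<And>t x. x \<in> space M \<Longrightarrow> ((\<lambda>t. f t x) has_vector_derivative f' t x) (at t)"
    and bound: "\<And>t x. x \<in> space M \<Longrightarrow> norm (f' t x) \<le> g x"
    and g: "integrable M g"
  shows "((\<lambda>t. integral\<^sup>L M (f t)) has_vector_derivative integral\<^sup>L M (f' t)) (at t)"
proof -
  have "((\<lambda>h. (integral\<^sup>L M (f (t + h)) - integral\<^sup>L M (f t)) /\<^sub>R h) \<longlongrightarrow> integral\<^sup>L M (f' t)) (at 0)"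
    unfolding tendsto_at_iff_sequentially
  proof (intro allI impI)
    fix X :: "nat \<Rightarrow> real"
    assume X: "\<forall>i. X i \<in> UNIV - {0}" "X \<longlonglongrightarrow> 0"
    have lin: "norm (f (t + h) x - f t x) \<le> \<bar>h\<bar> * g x" if x: "x \<in> space M" for h x
    proof -
      have "norm (f (t + h) x - f t x) \<le> g x * norm (t + h - t)"
      proof (rule differentiable_bound[where S = UNIV and f' = "\<lambda>s u. u *\<^sub>R f' s x"])
        show "((\<lambda>t. f t x) has_derivative (\<lambda>u. u *\<^sub>R f' s x)) (at s within UNIV)" for s
          using deriv[OF x] by (simp add: has_vector_derivative_def)
        show "onorm (\<lambda>u. u *\<^sub>R f' s x) \<le> g x" for s
          using bound[OF x] by (intro onorm_le) (simp add: mult_left_mono mult.commute)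
      qed auto
      then show ?thesis by (simp add: mult.commute)
    qed
    have "(\<lambda>n. \<integral>x. (f (t + X n) x - f t x) /\<^sub>R X n \<partial>M) \<longlonglongrightarrow> integral\<^sup>L M (f' t)"
    proof (rule integral_dominated_convergence[where w = g])
      show "AE x in M. (\<lambda>n. (f (t + X n) x - f t x) /\<^sub>R X n) \<longlonglongrightarrow> f' t x"
      proof (rule AE_I2)
        fix x assume "x \<in> space M"
        then have "((\<lambda>h. (f (t + h) x - f t x) /\<^sub>R h) \<longlongrightarrow> f' t x) (at 0)"
          using deriv[of x t] by (simp add: has_vector_derivative_at_iff)
        then show "(\<lambda>n. (f (t + X n) x - f t x) /\<^sub>R X n) \<longlonglongrightarrow> f' t x"
          unfolding tendsto_at_iff_sequentially using X by (auto simp: o_def)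
      qed
      show "AE x in M. norm ((f (t + X n) x - f t x) /\<^sub>R X n) \<le> g x" for n
      proof (rule AE_I2)
        fix x assume "x \<in> space M"
        then have "norm (f (t + X n) x - f t x) / \<bar>X n\<bar> \<le> g x"
          using lin[of x "X n"] X(1) by (simp add: pos_divide_le_eq mult.commute)
        then show "norm ((f (t + X n) x - f t x) /\<^sub>R X n) \<le> g x"
          by (simp add: divide_inverse mult.commute)
      qed
      show "(\<lambda>x. (f (t + X n) x - f t x) /\<^sub>R X n) \<in> borel_measurable M" for n
        using int by simp
    qed (fact meas g)+
    then show "((\<lambda>h. (integral\<^sup>L M (f (t + h)) - integral\<^sup>L M (f t)) /\<^sub>R h) \<circ> X) \<longlonglongrightarrow> integral\<^sup>L M (f' t)"
      using int by (simp add: o_def)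
  qed
  then show ?thesis
    by (simp add: has_vector_derivative_at_iff)
qed

section \<open>The logarithm of a diagonal matrix\<close>

definition diag_matrix :: "('n \<Rightarrow> 'a) \<Rightarrow> 'a :: zero ^ 'n ^ 'n" where
  "diag_matrix d = (\<chi> i j. if i = j then d i else 0)"

lemma diag_matrix_entry: "diag_matrix d $ i $ j = (if i = j then d i else 0)"
  by (simp add: diag_matrix_def)

lemma matpow_diag_matrix: "matpow (diag_matrix d) k = diag_matrix (\<lambda>i. d i ^ k)"
proof (induction k)
  case 0
  then show ?case by (simp add: vec_eq_iff diag_matrix_entry mat_def)
next
  case (Suc k)
  then show ?case
    by (simp add: vec_eq_iff diag_matrix_entry matrix_matrix_mult_def
        if_distrib[of "\<lambda>c. c * _"] cong: if_cong)
qed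

text \<open>Powers of a diagonal matrix are taken entrywise, so each diagonal entry is the Taylor
  series of \<open>Ln\<close> at 1, convergent on the open unit disc around it.\<close>

lemma matlog_diag_matrix:
  assumes "\<And>i. norm (d i - 1) < 1"
  shows "matlog (diag_matrix d) = diag_matrix (\<lambda>i. Ln (d i))"
  unfolding matlog_def
proof (rule sums_unique[symmetric], unfold sums_vec_iff, intro allI)
  fix i j
  have eq: "diag_matrix d - mat 1 = diag_matrix (\<lambda>i. d i - 1)"
    by (simp add: vec_eq_iff diag_matrix_entry mat_def)
  have "(\<lambda>n. (- 1) ^ Suc (Suc n) / of_nat (Suc n) * (d i - 1) ^ Suc n) sums Ln (d i)"
    using Ln_series[OF assms[of i]] by (subst sums_Suc_iff) simp
  then show "(\<lambda>k. (((- 1) ^ k / real (Suc k)) *\<^sub>R matpow (diag_matrix d - mat 1) (Suc k)) $ i $ j)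
      sums (diag_matrix (\<lambda>i. Ln (d i)) $ i $ j)"
    unfolding eq matpow_diag_matrix vector_scaleR_component
    by (auto simp add: diag_matrix_entry scaleR_conv_of_real simp del: power_Suc of_nat_Suc)
      (simp only: power_Suc mult_minus1 minus_minus)
qed

text \<open>The first three derivatives of \<open>Ln \<circ> \<phi>\<close> in terms of \<open>a = \<phi>\<close>, \<open>b = \<phi>'\<close>, \<open>c = \<phi>''\<close>, \<open>d = \<phi>'''\<close>.\<close>

fun log_derivs :: "nat \<Rightarrow> complex \<Rightarrow> complex \<Rightarrow> complex \<Rightarrow> complex \<Rightarrow> complex" where
  "log_derivs 0 a b c d = Ln a"
| "log_derivs (Suc 0) a b c d = b / a"
| "log_derivs (Suc (Suc 0)) a b c d = c / a - (b / a)\<^sup>2"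
| "log_derivs (Suc (Suc (Suc _))) a b c d = d / a - 3 * (b / a) * (c / a) + 2 * (b / a) ^ 3"

text \<open>Distance less than 1 from 1 puts \<phi> 0 t in the open right half-plane. There it is
  nonzero and off the branch cut, so the chain rule for \<open>Ln\<close> and the rule for
  reciprocals apply.\<close>

lemma log_derivs_deriv:
  assumes \<phi>: "\<And>m. m < 3 \<Longrightarrow> (\<phi> m has_vector_derivative \<phi> (Suc m) t) (at t)"
    and near: "norm (\<phi> 0 t - 1) < 1" and "k < 3"
  shows "((\<lambda>s. log_derivs k (\<phi> 0 s) (\<phi> 1 s) (\<phi> 2 s) (\<phi> 3 s)) has_vector_derivative
    log_derivs (Suc k) (\<phi> 0 t) (\<phi> 1 t) (\<phi> 2 t) (\<phi> 3 t)) (at t)"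
proof -
  note d0 = \<phi>[of 0, simplified] and d1 = \<phi>[of 1, simplified] and d2 = \<phi>[of 2, simplified]
  have d1': "(\<phi> 1 has_vector_derivative \<phi> 2 t) (at t)"
    using d1 by (simp add: numeral_2_eq_2)
  have d2': "(\<phi> 2 has_vector_derivative \<phi> 3 t) (at t)"
    using d2 by (simp add: numeral_3_eq_3 numeral_2_eq_2)
  have "\<bar>Re (\<phi> 0 t - 1)\<bar> < 1"
    using near abs_Re_le_cmod[of "\<phi> 0 t - 1"] by linarith
  then have pos: "Re (\<phi> 0 t) > 0"
    by simp
  then have nz: "\<phi> 0 t \<noteq> 0" and cut: "\<phi> 0 t \<notin> \<real>\<^sub>\<le>\<^sub>0"
    by (auto simp: complex_nonpos_Reals_iff)
  have "(Ln has_field_derivative inverse (\<phi> 0 t)) (at (\<phi> 0 t))"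
    using has_field_derivative_Ln[OF cut] .
  from field_vector_diff_chain_at[OF d0 this]
  have D0: "((\<lambda>s. Ln (\<phi> 0 s)) has_vector_derivative \<phi> 1 t / \<phi> 0 t) (at t)"
    by (simp add: o_def divide_inverse)
  have "(inverse has_field_derivative - (inverse (\<phi> 0 t) ^ 2)) (at (\<phi> 0 t))"
    using DERIV_inverse[OF nz] by (simp add: numeral_2_eq_2)
  from field_vector_diff_chain_at[OF d0 this]
  have inv: "((\<lambda>s. inverse (\<phi> 0 s)) has_vector_derivative - \<phi> 1 t * inverse (\<phi> 0 t) ^ 2) (at t)"
    by (simp add: o_def)
  note D1 = has_vector_derivative_mult[OF d1' inv] and E1 = has_vector_derivative_mult[OF d2' inv]
  note D2 = has_vector_derivative_diff[OF E1 has_vector_derivative_mult[OF D1 D1]]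
  consider "k = 0" | "k = 1" | "k = 2"
    using \<open>k < 3\<close> by linarith
  then show ?thesis
  proof cases
    case 1
    with D0 show ?thesis by simp
  next
    case 2
    from D1 show ?thesis
      by (simp add: 2 divide_inverse) (simp add: algebra_simps power2_eq_square)
  next
    case 3
    from D2 show ?thesis
      by (simp add: 3 eval_nat_numeral divide_inverse) (simp add: algebra_simps power2_eq_square)
  qed
qed

section \<open>Random variables with finite moments\<close>

text \<open>Demanding all orders at once gives a class closed under sums and products, hence under
  entries of matrix powers, without counting exponents.\<close>

definition finite_moments :: "'a measure \<Rightarrow> ('a \<Rightarrow> complex) \<Rightarrow> bool" where
  "finite_moments M X \<longleftrightarrow> X \<in> borel_measurable M \<and> (\<forall>p. integrable M (\<lambda>\<omega>. norm (X \<omega>) ^ p))"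

lemma finite_moments_measurable: "finite_moments M X \<Longrightarrow> X \<in> borel_measurable M"
  by (simp add: finite_moments_def)

lemma finite_moments_integrable:
  assumes "finite_moments M X" shows "integrable M X"
proof -
  have "integrable M (\<lambda>\<omega>. norm (X \<omega>) ^ 1)"
    using assms unfolding finite_moments_def by blast
  then show ?thesis
    using assms by (simp add: finite_moments_def integrable_norm_iff)
qed

lemma (in finite_measure) finite_moments_const: "finite_moments M (\<lambda>_. c)"
  by (simp add: finite_moments_def)

lemma finite_moments_add:
  assumes "finite_moments M X" "finite_moments M Y"
  shows "finite_moments M (\<lambda>\<omega>. X \<omega> + Y \<omega>)"
  unfolding finite_moments_def
proof (intro conjI allI)
  have [measurable]: "X \<in> borel_measurable M" "Y \<in> borel_measurable M"
    using assms by (auto simp: finite_moments_def)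
  show "(\<lambda>\<omega>. X \<omega> + Y \<omega>) \<in> borel_measurable M"
    by measurable
  fix p
  show "integrable M (\<lambda>\<omega>. norm (X \<omega> + Y \<omega>) ^ p)"
  proof (rule Bochner_Integration.integrable_bound)
    show "integrable M (\<lambda>\<omega>. 2 ^ p * (norm (X \<omega>) ^ p + norm (Y \<omega>) ^ p))"
      using assms by (auto simp: finite_moments_def)
    have "norm (x + y) ^ p \<le> 2 ^ p * (norm x ^ p + norm y ^ p)" for x y :: complex
    proof -
      have "norm (x + y) ^ p \<le> (2 * max (norm x) (norm y)) ^ p"
        by (intro power_mono) (use norm_triangle_ineq[of x y] in auto)
      also have "\<dots> \<le> 2 ^ p * (norm x ^ p + norm y ^ p)"
        unfolding power_mult_distrib by (intro mult_left_mono) (auto simp: max_def)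
      finally show ?thesis .
    qed
    then show "AE \<omega> in M. norm (norm (X \<omega> + Y \<omega>) ^ p) \<le> norm (2 ^ p * (norm (X \<omega>) ^ p + norm (Y \<omega>) ^ p))"
      by (intro AE_I2) simp
  qed measurable
qed

text \<open>Without any independence, a b \<le> a^2 + b^2 bounds the p-th moment of the product by
  the moments of order 2p of the factors.\<close>

lemma finite_moments_mult:
  assumes "finite_moments M X" "finite_moments M Y"
  shows "finite_moments M (\<lambda>\<omega>. X \<omega> * Y \<omega>)"
  unfolding finite_moments_def
proof (intro conjI allI)
  have [measurable]: "X \<in> borel_measurable M" "Y \<in> borel_measurable M"
    using assms by (auto simp: finite_moments_def)
  show "(\<lambda>\<omega>. X \<omega> * Y \<omega>) \<in> borel_measurable M"
    by measurable
  fix p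
  show "integrable M (\<lambda>\<omega>. norm (X \<omega> * Y \<omega>) ^ p)"
  proof (rule Bochner_Integration.integrable_bound)
    show "integrable M (\<lambda>\<omega>. norm (X \<omega>) ^ (2 * p) + norm (Y \<omega>) ^ (2 * p))"
      using assms by (auto simp: finite_moments_def)
    have "norm (x * y) ^ p \<le> norm x ^ (2 * p) + norm y ^ (2 * p)" for x y :: complex
    proof -
      have "a * b \<le> a\<^sup>2 + b\<^sup>2" if "0 \<le> a" "0 \<le> b" for a b :: real
        using sum_squares_bound[of a b] mult_nonneg_nonneg[OF that] by simp
      from this[of "norm x ^ p" "norm y ^ p"] show ?thesis
        by (simp add: norm_mult power_mult_distrib power_even_eq)
    qed
    then show "AE \<omega> in M. norm (norm (X \<omega> * Y \<omega>) ^ p) \<le> norm (norm (X \<omega>) ^ (2 * p) + norm (Y \<omega>) ^ (2 * p))"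
      by (intro AE_I2) simp
  qed measurable
qed

lemma (in finite_measure) finite_moments_sum:
  assumes "\<And>i. i \<in> A \<Longrightarrow> finite_moments M (X i)"
  shows "finite_moments M (\<lambda>\<omega>. \<Sum>i\<in>A. X i \<omega>)"
  using assms
  by (induction A rule: infinite_finite_induct) (auto intro: finite_moments_const finite_moments_add)

lemma (in finite_measure) finite_moments_matpow:
  assumes "\<And>i j. finite_moments M (\<lambda>\<omega>. X \<omega> $ i $ j)"
  shows "finite_moments M (\<lambda>\<omega>. matpow (X \<omega>) k $ i $ j)"
proof (induction k arbitrary: i j)
  case 0
  then show ?case by (simp add: finite_moments_const)
next
  case (Suc k)
  then show ?case
    unfolding matpow_Suc_entry by (intro finite_moments_sum finite_moments_mult assms)
qed

section \<open>Cumulants of Hermitian matrices with diagonal characteristic function\<close>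

lemma matpow_entry_measurable:
  assumes "\<And>i j. (\<lambda>\<omega>. X \<omega> $ i $ j) \<in> borel_measurable M"
  shows "(\<lambda>\<omega>. matpow (X \<omega>) k $ i $ j) \<in> borel_measurable M"
proof (induction k arbitrary: i j)
  case 0
  then show ?case by simp
next
  case (Suc k)
  note [measurable] = assms Suc
  show ?case
    unfolding matpow_Suc_entry by measurable
qed

lemma exp_entry_measurable:
  assumes "\<And>i j. (\<lambda>\<omega>. X \<omega> $ i $ j) \<in> borel_measurable M"
  shows "(\<lambda>\<omega>. exp_entry (X \<omega>) i j z) \<in> borel_measurable M"
proof -
  note [measurable] = matpow_entry_measurable[OF assms]
  show ?thesis
    unfolding exp_entry_def expcoef_def by measurable
qed

lemma exp_entry_derivs_measurable:
  assumes "\<And>i j. (\<lambda>\<omega>. X \<omega> $ i $ j) \<in> borel_measurable M"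
  shows "(\<lambda>\<omega>. exp_entry_derivs m (X \<omega>) i j z) \<in> borel_measurable M"
proof -
  note [measurable] = matpow_entry_measurable[OF assms] exp_entry_measurable[OF assms]
  show ?thesis
    unfolding exp_entry_derivs_def by measurable
qed

text \<open>Restricted to the diagonal, where the cumulants live once the characteristic function is
  diagonal.\<close>

definition mat_moment :: "'a measure \<Rightarrow> nat \<Rightarrow> ('a \<Rightarrow> complex ^ 'n ^ 'n) \<Rightarrow> 'n \<Rightarrow> complex" where
  "mat_moment M m X i = integral\<^sup>L M (\<lambda>\<omega>. matpow (X \<omega>) m $ i $ i)"

text \<open>With E exp(i t X) diagonal for all real \<open>t\<close>, the logarithm acts on scalar
  functions. Differentiation under the expectation gives their derivatives at 0 as i^k times the
  k-th moment, which are the arguments passed to \<open>log_derivs\<close>.\<close>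

lemma (in prob_space) mat_cumulant_diagonal:
  fixes X :: "'a \<Rightarrow> complex ^ 'n ^ 'n"
  assumes mom: "\<And>i j. finite_moments M (\<lambda>\<omega>. X \<omega> $ i $ j)"
    and herm: "\<And>\<omega> i j. X \<omega> $ i $ j = cnj (X \<omega> $ j $ i)"
    and offdiag: "\<And>t i j. i \<noteq> j \<Longrightarrow> integral\<^sup>L M (\<lambda>\<omega>. exp_entry (X \<omega>) i j (complex_of_real t)) = 0"
    and n: "n \<le> 3"
  shows "mat_cumulant M n X = diag_matrix (\<lambda>i. inverse (\<i> ^ n) *
    log_derivs n 1 (\<i> * mat_moment M 1 X i) (- mat_moment M 2 X i) (- \<i> * mat_moment M 3 X i))"
proof -
  define \<phi> where "\<phi> m i t = integral\<^sup>L M (\<lambda>\<omega>. exp_entry_derivs m (X \<omega>) i i (complex_of_real t))" for m i t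
  have meas: "(\<lambda>\<omega>. X \<omega> $ i $ j) \<in> borel_measurable M" for i j
    using mom by (rule finite_moments_measurable)
  have g: "integrable M (\<lambda>\<omega>. \<Sum>l\<in>UNIV. norm (matpow (X \<omega>) m $ i $ l))" for m i
    by (intro Bochner_Integration.integrable_sum integrable_norm finite_moments_integrable
        finite_moments_matpow mom)
  have bound: "norm (exp_entry_derivs m (X \<omega>) i j (complex_of_real t)) \<le> (\<Sum>l\<in>UNIV. norm (matpow (X \<omega>) m $ i $ l))"
    for m \<omega> i j t
    using herm by (rule norm_exp_entry_derivs_le)
  have int: "integrable M (\<lambda>\<omega>. exp_entry_derivs m (X \<omega>) i j (complex_of_real t))" for m i j t
    by (rule Bochner_Integration.integrable_bound[OF g exp_entry_derivs_measurable[OF meas]])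
      (rule AE_I2, rule order_trans[OF bound], unfold real_norm_def, rule abs_ge_self)
  have d\<phi>: "(\<phi> m i has_vector_derivative \<phi> (Suc m) i t) (at t)" for m i t
    unfolding \<phi>_def[abs_def]
    by (rule has_vector_derivative_integral[OF int exp_entry_derivs_measurable[OF meas]
          exp_entry_derivs_deriv bound g])
  have char: "mat_char M X t = diag_matrix (\<lambda>i. \<phi> 0 i t)" for t
    using offdiag
    by (simp add: vec_eq_iff mat_char_def matexpectation_def matexp_entry diag_matrix_entry
        \<phi>_def exp_entry_derivs_0)
  have \<phi>0: "\<phi> m i 0 = \<i> ^ m * mat_moment M m X i" for m i
    by (simp add: \<phi>_def exp_entry_derivs_at_0 mat_moment_def)
  \<comment> \<open>The neighbourhood of 0 on which the logarithm series converges for all diagonal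
    entries; it is open as a finite intersection.\<close>
  define S where "S = (\<Inter>i. {t. norm (\<phi> 0 i t - 1) < 1})"
  have "isCont (\<phi> 0 i) t" for i t
    using d\<phi> has_vector_derivative_continuous by blast
  then have "open S"
    unfolding S_def
    by (intro open_INT ballI finite open_Collect_less continuous_intros) (auto simp: continuous_on_eq_continuous_at)
  have "0 \<in> S"
    by (simp add: S_def \<phi>0 mat_moment_def prob_space mat_def)
  define F where "F k t = diag_matrix (\<lambda>i. log_derivs k (\<phi> 0 i t) (\<phi> 1 i t) (\<phi> 2 i t) (\<phi> 3 i t))" for k t
  have "higher_vector_deriv n (mat_log_char M X) 0 = F n 0"
  proof (rule higher_vector_deriv_eq[OF \<open>open S\<close> _ _ \<open>0 \<in> S\<close>])
    fix k t assume k: "k < n" and t: "t \<in> S"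
    show "(F k has_vector_derivative F (Suc k) t) (at t)"
      unfolding F_def[abs_def]
    proof (intro has_vector_derivative_vec)
      fix i j
      have "norm (\<phi> 0 i t - 1) < 1" "k < 3"
        using t k n by (auto simp: S_def)
      from log_derivs_deriv[where \<phi> = "\<lambda>m. \<phi> m i", OF d\<phi> this]
      show "((\<lambda>t. diag_matrix (\<lambda>i. log_derivs k (\<phi> 0 i t) (\<phi> 1 i t) (\<phi> 2 i t) (\<phi> 3 i t)) $ i $ j)
          has_vector_derivative
          diag_matrix (\<lambda>i. log_derivs (Suc k) (\<phi> 0 i t) (\<phi> 1 i t) (\<phi> 2 i t) (\<phi> 3 i t)) $ i $ j) (at t)"
        by (cases "i = j") (simp_all add: diag_matrix_entry)
    qed
  next
    fix t assume "t \<in> S"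
    then show "mat_log_char M X t = F 0 t"
      by (simp add: mat_log_char_def char F_def S_def matlog_diag_matrix)
  qed
  then show ?thesis
    by (simp add: mat_cumulant_def F_def vec_eq_iff cscale_def map_matrix_def diag_matrix_entry \<phi>0
        eval_nat_numeral prob_space)
      (simp add: mat_moment_def prob_space mat_def)
qed

corollary (in prob_space) mat_cumulant_diagonal_le_3:
  fixes X :: "'a \<Rightarrow> complex ^ 'n ^ 'n"
  assumes mom: "\<And>i j. finite_moments M (\<lambda>\<omega>. X \<omega> $ i $ j)"
    and herm: "\<And>\<omega> i j. X \<omega> $ i $ j = cnj (X \<omega> $ j $ i)"
    and offdiag: "\<And>t i j. i \<noteq> j \<Longrightarrow> integral\<^sup>L M (\<lambda>\<omega>. exp_entry (X \<omega>) i j (complex_of_real t)) = 0"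
  shows mat_cumulant_1: "mat_cumulant M 1 X = diag_matrix (mat_moment M 1 X)"
    and mat_cumulant_2: "mat_cumulant M 2 X =
      diag_matrix (\<lambda>i. mat_moment M 2 X i - (mat_moment M 1 X i)\<^sup>2)"
    and mat_cumulant_3: "mat_cumulant M 3 X = diag_matrix (\<lambda>i. mat_moment M 3 X i
      - 3 * mat_moment M 1 X i * mat_moment M 2 X i + 2 * mat_moment M 1 X i ^ 3)"
  using mat_cumulant_diagonal[OF assms, of 1] mat_cumulant_diagonal[OF assms, of 2]
    mat_cumulant_diagonal[OF assms, of 3]
  by (simp_all add: vec_eq_iff diag_matrix_entry eval_nat_numeral algebra_simps)

section \<open>Independence\<close>

text \<open>A centred factor independent of the other two annihilates the product. The indices
  \<open>s\<close> and \<open>u\<close> may coincide, so this also covers mixed products such as V_r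
  V_s V_s, and pairs when one factor is constant.\<close>

lemma (in prob_space) indep_triple_expectation_zero:
  fixes f g k :: "'b \<Rightarrow> complex"
  assumes indep: "indep_vars (\<lambda>_. N) X I" and I: "r \<in> I" "s \<in> I" "u \<in> I" and "r \<noteq> s" "r \<noteq> u"
    and meas: "f \<in> borel_measurable N" "g \<in> borel_measurable N" "k \<in> borel_measurable N"
    and mom: "finite_moments M (\<lambda>\<omega>. f (X r \<omega>))" "finite_moments M (\<lambda>\<omega>. g (X s \<omega>))"
      "finite_moments M (\<lambda>\<omega>. k (X u \<omega>))"
    and zero: "expectation (\<lambda>\<omega>. f (X r \<omega>)) = 0"
  shows "expectation (\<lambda>\<omega>. f (X r \<omega>) * g (X s \<omega>) * k (X u \<omega>)) = 0"
proof -
  let ?J = "{r, s, u}"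
  \<comment> \<open>\<open>Y q\<close> collects all factors attached to index \<open>q\<close>, so
    the product over the set {r, s, u} is correct whether or not \<open>s\<close> and
    \<open>u\<close> are equal.\<close>
  define Y where "Y q x = (if q = r then f x else 1) * (if q = s then g x else 1) * (if q = u then k x else 1)" for q x
  have "expectation (\<lambda>\<omega>. \<Prod>q\<in>?J. Y q (X q \<omega>)) = (\<Prod>q\<in>?J. expectation (\<lambda>\<omega>. Y q (X q \<omega>)))"
  proof (rule indep_vars_lebesgue_integral)
    show "indep_vars (\<lambda>_. borel) (\<lambda>q \<omega>. Y q (X q \<omega>)) ?J"
    proof (rule indep_vars_compose2[where X = X and Y = Y and M' = "\<lambda>_. N"])
      show "indep_vars (\<lambda>_. N) X ?J"
        using indep I by (intro indep_vars_subset[OF indep]) auto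
      show "Y q \<in> borel_measurable N" for q
        unfolding Y_def by (intro borel_measurable_times) (use meas in auto)
    qed
    show "integrable M (\<lambda>\<omega>. Y q (X q \<omega>))" for q
    proof -
      have "finite_moments M (\<lambda>\<omega>. if c then F \<omega> else 1)" if "c \<Longrightarrow> finite_moments M F" for c F
        using that by (cases c) (auto simp: finite_moments_const)
      then show ?thesis
        unfolding Y_def using mom
        by (intro finite_moments_integrable finite_moments_mult) auto
    qed
  qed simp
  also have "expectation (\<lambda>\<omega>. Y r (X r \<omega>)) = 0"
    using zero \<open>r \<noteq> s\<close> \<open>r \<noteq> u\<close> by (simp add: Y_def)
  then have "(\<Prod>q\<in>?J. expectation (\<lambda>\<omega>. Y q (X q \<omega>))) = 0"
    by (intro prod_zero) auto
  finally have "expectation (\<lambda>\<omega>. \<Prod>q\<in>?J. Y q (X q \<omega>)) = 0" .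
  moreover have "(\<Prod>q\<in>?J. Y q (X q \<omega>)) = f (X r \<omega>) * g (X s \<omega>) * k (X u \<omega>)" for \<omega>
    using \<open>r \<noteq> s\<close> \<open>r \<noteq> u\<close> by (cases "s = u") (auto simp: Y_def)
  ultimately show ?thesis
    by simp
qed

section \<open>Complex Gaussian vectors\<close>

lemma (in prob_space) finite_moments_of_normal:
  assumes D: "distributed M lborel X (normal_density 0 \<sigma>)" and "\<sigma> > 0"
  shows "finite_moments M (\<lambda>\<omega>. complex_of_real (X \<omega>))"
  unfolding finite_moments_def
proof (intro conjI allI)
  have [measurable]: "X \<in> borel_measurable M"
    using distributed_measurable[OF D] by simp
  show "(\<lambda>\<omega>. complex_of_real (X \<omega>)) \<in> borel_measurable M"
    by measurable
  fix p
  have "integrable M (\<lambda>\<omega>. \<bar>X \<omega>\<bar> ^ p)"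
    using distributed_integrable[OF D, of "\<lambda>x. \<bar>x\<bar> ^ p"] integrable_normal_moment_abs[OF \<open>\<sigma> > 0\<close>, of 0 p]
    by simp
  then show "integrable M (\<lambda>\<omega>. norm (complex_of_real (X \<omega>)) ^ p)"
    by simp
qed

lemma borel_measurable_cnj [measurable (raw)]:
  "f \<in> borel_measurable N \<Longrightarrow> (\<lambda>x. cnj (f x)) \<in> borel_measurable N"
  by (rule borel_measurable_continuous_on[of cnj]) (intro continuous_intros)

lemma finite_moments_cnj: "finite_moments M X \<Longrightarrow> finite_moments M (\<lambda>\<omega>. cnj (X \<omega>))"
  by (simp add: finite_moments_def borel_measurable_cnj)

context prob_space
begin

lemma std_complex_gaussian_finite_moments:
  assumes "std_complex_gaussian M Z"
  shows "finite_moments M Z"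
proof -
  have "finite_moments M (\<lambda>\<omega>. complex_of_real (Re (Z \<omega>)) + \<i> * complex_of_real (Im (Z \<omega>)))"
    using assms unfolding std_complex_gaussian_def
    by (intro finite_moments_add finite_moments_mult finite_moments_const
        finite_moments_of_normal[of _ "sqrt (1 / 2)"]) auto
  then show ?thesis
    by (simp flip: complex_eq)
qed

lemma normal_second_moment:
  assumes D: "distributed M lborel X (normal_density 0 \<sigma>)" and "\<sigma> > 0"
  shows "expectation (\<lambda>\<omega>. (X \<omega>)\<^sup>2) = \<sigma>\<^sup>2"
  using normal_distributed_variance[OF \<open>\<sigma> > 0\<close> D] normal_distributed_expectation[OF \<open>\<sigma> > 0\<close> D]
  by simp

lemma std_complex_gaussian_moments:
  assumes "std_complex_gaussian M Z"
  shows "expectation Z = 0" and "expectation (\<lambda>\<omega>. Z \<omega> * cnj (Z \<omega>)) = 1"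
proof -
  have R: "distributed M lborel (\<lambda>\<omega>. Re (Z \<omega>)) (normal_density 0 (sqrt (1 / 2)))"
    and I: "distributed M lborel (\<lambda>\<omega>. Im (Z \<omega>)) (normal_density 0 (sqrt (1 / 2)))"
    using assms by (simp_all add: std_complex_gaussian_def)
  note fR = finite_moments_of_normal[OF R, simplified] and fI = finite_moments_of_normal[OF I, simplified]
  have intZ: "integrable M Z"
    using assms by (intro finite_moments_integrable std_complex_gaussian_finite_moments)
  have "Re (expectation Z) = 0" "Im (expectation Z) = 0"
    using normal_distributed_expectation[OF _ R] normal_distributed_expectation[OF _ I] intZ
    by simp_all
  then show "expectation Z = 0"
    by (simp add: complex_eq_iff)
  have "integrable M (\<lambda>\<omega>. norm (complex_of_real (Re (Z \<omega>))) ^ 2)" "integrable M (\<lambda>\<omega>. norm (complex_of_real (Im (Z \<omega>))) ^ 2)"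
    using fR fI unfolding finite_moments_def by blast+
  then have "expectation (\<lambda>\<omega>. (Re (Z \<omega>))\<^sup>2 + (Im (Z \<omega>))\<^sup>2) = 1"
    using normal_second_moment[OF R] normal_second_moment[OF I]
    by (simp add: power2_abs power_divide)
  moreover have "expectation (\<lambda>\<omega>. Z \<omega> * cnj (Z \<omega>)) = expectation (\<lambda>\<omega>. complex_of_real ((Re (Z \<omega>))\<^sup>2 + (Im (Z \<omega>))\<^sup>2))"
    by (simp only: complex_mult_cnj)
  ultimately show "expectation (\<lambda>\<omega>. Z \<omega> * cnj (Z \<omega>)) = 1"
    by (simp only: integral_complex_of_real of_real_1)
qed

lemma gaussian_vector_finite_moments:
  "iid_complex_gaussian_vector M h \<Longrightarrow> finite_moments M (\<lambda>\<omega>. h \<omega> $ i)"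
  by (simp add: iid_complex_gaussian_vector_def std_complex_gaussian_finite_moments)

lemma gaussian_vector_second_moment:
  assumes h: "iid_complex_gaussian_vector M h"
  shows "expectation (\<lambda>\<omega>. h \<omega> $ i * cnj (h \<omega> $ j)) = (if i = j then 1 else 0)"
proof (cases "i = j")
  case True
  then show ?thesis
    using h std_complex_gaussian_moments(2)[of "\<lambda>\<omega>. h \<omega> $ i"]
    by (simp add: iid_complex_gaussian_vector_def)
next
  case False
  have "expectation (\<lambda>\<omega>. h \<omega> $ i * cnj (h \<omega> $ j) * 1) = 0"
    using h False
    by (intro indep_triple_expectation_zero[where N = borel and I = UNIV and X = "\<lambda>i \<omega>. h \<omega> $ i"
          and f = "\<lambda>z. z" and g = cnj and k = "\<lambda>_. 1" and u = j])
      (auto simp: finite_moments_const finite_moments_cnj gaussian_vector_finite_moments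
        iid_complex_gaussian_vector_def std_complex_gaussian_moments std_complex_gaussian_finite_moments
        intro: borel_measurable_cnj)
  with False show ?thesis
    by simp
qed

text \<open>Centring one factor makes the independence lemma applicable: |h_i|^2 - 1 has mean zero,
  so the expectation reduces to that of |h_j|^2, which is 1.\<close>

lemma gaussian_vector_fourth_moment:
  assumes h: "iid_complex_gaussian_vector M h" and "i \<noteq> j"
  shows "expectation (\<lambda>\<omega>. (h \<omega> $ i * cnj (h \<omega> $ i)) * (h \<omega> $ j * cnj (h \<omega> $ j))) = 1"
proof -
  have fm: "finite_moments M (\<lambda>\<omega>. h \<omega> $ a * cnj (h \<omega> $ a))" for a
    by (intro finite_moments_mult finite_moments_cnj gaussian_vector_finite_moments h)
  have fm1: "finite_moments M (\<lambda>\<omega>. h \<omega> $ a * cnj (h \<omega> $ a) + (- 1))" for a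
    by (intro finite_moments_add fm finite_moments_const)
  have one: "expectation (\<lambda>\<omega>. h \<omega> $ a * cnj (h \<omega> $ a)) = 1" for a
    using gaussian_vector_second_moment[OF h, of a a] by simp
  have "expectation (\<lambda>\<omega>. (h \<omega> $ i * cnj (h \<omega> $ i) + (- 1)) * (h \<omega> $ j * cnj (h \<omega> $ j)) * 1) = 0"
  proof (rule indep_triple_expectation_zero[where N = borel and I = UNIV and X = "\<lambda>i \<omega>. h \<omega> $ i"
          and f = "\<lambda>z. z * cnj z + (- 1)" and g = "\<lambda>z. z * cnj z" and k = "\<lambda>_. 1" and u = j])
    show "expectation (\<lambda>\<omega>. h \<omega> $ i * cnj (h \<omega> $ i) + - 1) = 0"
      using finite_moments_integrable[OF fm[of i]] one[of i] by (simp add: prob_space)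
    show "(\<lambda>z. z * cnj z + (- 1)) \<in> borel_measurable borel" "(\<lambda>z. z * cnj z) \<in> borel_measurable borel"
      by measurable
  qed (use h \<open>i \<noteq> j\<close> fm fm1 in \<open>auto simp: finite_moments_const iid_complex_gaussian_vector_def\<close>)
  moreover have "expectation (\<lambda>\<omega>. (h \<omega> $ i * cnj (h \<omega> $ i) + (- 1)) * (h \<omega> $ j * cnj (h \<omega> $ j)) * 1) =
      expectation (\<lambda>\<omega>. (h \<omega> $ i * cnj (h \<omega> $ i)) * (h \<omega> $ j * cnj (h \<omega> $ j)) - h \<omega> $ j * cnj (h \<omega> $ j))"
    by (simp add: algebra_simps)
  ultimately show ?thesis
    using one[of j] finite_moments_integrable[OF finite_moments_mult[OF fm[of i] fm[of j]]]
      finite_moments_integrable[OF fm[of j]]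
    by simp
qed

section \<open>Sign symmetry\<close>

lemma std_complex_gaussian_uminus:
  assumes "std_complex_gaussian M Z"
  shows "std_complex_gaussian M (\<lambda>\<omega>. - Z \<omega>)"
proof -
  have "distributed M lborel (\<lambda>\<omega>. - X \<omega>) (normal_density 0 \<sigma>)"
    if "distributed M lborel X (normal_density 0 \<sigma>)" "\<sigma> > 0" for X \<sigma>
    using normal_density_affine[OF that, of "- 1" 0] by simp
  moreover have "indep_var borel (uminus \<circ> (\<lambda>\<omega>. Re (Z \<omega>))) borel (uminus \<circ> (\<lambda>\<omega>. Im (Z \<omega>)))"
    using assms by (intro indep_var_compose) (auto simp: std_complex_gaussian_def)
  ultimately show ?thesis
    using assms by (simp add: std_complex_gaussian_def o_def)
qed

text \<open>The marginals of the real and imaginary parts together with their independence determine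
  the law, as the image of a product measure under \<open>Complex\<close>.\<close>

lemma std_complex_gaussian_distr_eq:
  assumes "std_complex_gaussian M Z" "std_complex_gaussian M Z'"
  shows "distr M borel Z = distr M borel Z'"
proof -
  \<comment> \<open>The normal law restated with target \<open>borel\<close>, the space in which the
    independence of the two parts is formulated.\<close>
  define \<mu> where "\<mu> = distr (density lborel (normal_density 0 (sqrt (1 / 2)))) borel (\<lambda>x. x)"
  have "distr M borel Z = distr (\<mu> \<Otimes>\<^sub>M \<mu>) borel (\<lambda>(x, y). Complex x y)" if Z: "std_complex_gaussian M Z" for Z
  proof -
    have D: "distr M borel X = \<mu>" if X: "distributed M lborel X (normal_density 0 (sqrt (1 / 2)))" for X
    proof -
      have "\<mu> = distr (distr M lborel X) borel (\<lambda>x. x)"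
        unfolding \<mu>_def distributed_distr_eq_density[OF X] ..
      also have "\<dots> = distr M borel X"
        using distributed_measurable[OF X] by (subst distr_distr) (simp_all add: o_def)
      finally show ?thesis ..
    qed
    have "distr M borel (\<lambda>\<omega>. Re (Z \<omega>)) \<Otimes>\<^sub>M distr M borel (\<lambda>\<omega>. Im (Z \<omega>)) =
        distr M (borel \<Otimes>\<^sub>M borel) (\<lambda>\<omega>. (Re (Z \<omega>), Im (Z \<omega>)))"
      and [measurable]: "(\<lambda>\<omega>. Re (Z \<omega>)) \<in> borel_measurable M" "(\<lambda>\<omega>. Im (Z \<omega>)) \<in> borel_measurable M"
      using Z by (simp_all add: std_complex_gaussian_def indep_var_distribution_eq)
    then have eq: "\<mu> \<Otimes>\<^sub>M \<mu> = distr M (borel \<Otimes>\<^sub>M borel) (\<lambda>\<omega>. (Re (Z \<omega>), Im (Z \<omega>)))"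
      using Z by (simp add: D std_complex_gaussian_def)
    have [measurable]: "(\<lambda>(x, y). Complex x y) \<in> borel_measurable (borel \<Otimes>\<^sub>M borel)"
      unfolding Complex_eq by measurable
    show ?thesis
      unfolding eq by (subst distr_distr) (simp_all add: o_def)
  qed
  with assms show ?thesis by simp
qed

lemma borel_measurable_vec:
  fixes f :: "'b \<Rightarrow> 'c :: euclidean_space ^ 'n"
  assumes "\<And>i. (\<lambda>x. f x $ i) \<in> borel_measurable N"
  shows "f \<in> borel_measurable N"
proof (rule borel_measurable_euclidean_space[THEN iffD2], rule ballI)
  fix b :: "'c ^ 'n" assume "b \<in> Basis"
  then obtain i u where "b = axis i u"
    unfolding Basis_vec_def by blast
  then show "(\<lambda>x. f x \<bullet> b) \<in> borel_measurable N"
    using borel_measurable_inner[OF assms[of i] borel_measurable_const[of u]] by (simp add: inner_axis)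
qed

lemma gaussian_vector_measurable:
  "iid_complex_gaussian_vector M h \<Longrightarrow> h \<in> borel_measurable M"
  by (intro borel_measurable_vec finite_moments_measurable gaussian_vector_finite_moments)

text \<open>Independent coordinates make the law the image under \<open>vec_lambda\<close> of the
  product of the coordinate laws, and these agree.\<close>

lemma gaussian_vector_distr_eq:
  fixes h h' :: "'a \<Rightarrow> complex ^ 'n"
  assumes "iid_complex_gaussian_vector M h" "iid_complex_gaussian_vector M h'"
  shows "distr M borel h = distr M borel h'"
proof -
  have "distr M borel h = distr (\<Pi>\<^sub>M i\<in>UNIV. distr M borel (\<lambda>\<omega>. h \<omega> $ i)) borel vec_lambda"
    if h: "iid_complex_gaussian_vector M h" for h :: "'a \<Rightarrow> complex ^ 'n"
  proof -
    note [measurable] = finite_moments_measurable[OF gaussian_vector_finite_moments[OF h]]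
    have ind: "indep_vars (\<lambda>_. borel) (\<lambda>i \<omega>. h \<omega> $ i) UNIV"
      using h by (simp add: iid_complex_gaussian_vector_def)
    have eq: "(\<Pi>\<^sub>M i\<in>UNIV. distr M borel (\<lambda>\<omega>. h \<omega> $ i)) =
        distr M (\<Pi>\<^sub>M i\<in>UNIV. borel) (\<lambda>\<omega>. \<lambda>i\<in>UNIV. h \<omega> $ i)"
      by (rule indep_vars_iff_distr_eq_PiM[THEN iffD1, OF _ _ ind, symmetric]) auto
    have [measurable]: "vec_lambda \<in> borel_measurable (\<Pi>\<^sub>M i\<in>(UNIV :: 'n set). (borel :: complex measure))"
      by (intro borel_measurable_vec) simp
    show ?thesis
      unfolding eq by (subst distr_distr[OF _ measurable_restrict]) (simp_all add: o_def restrict_UNIV vec_nth_inverse)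
  qed
  moreover have "distr M borel (\<lambda>\<omega>. h \<omega> $ i) = distr M borel (\<lambda>\<omega>. h' \<omega> $ i)" for i
    using assms by (intro std_complex_gaussian_distr_eq) (simp_all add: iid_complex_gaussian_vector_def)
  ultimately show ?thesis
    using assms by simp
qed

text \<open>Both families have the same product law. It is used to compare a family with its
  sign-flipped copy; the restriction to \<open>I\<close> produces points of the product
  space.\<close>

lemma gaussian_family_expectation_eq:
  fixes h h' :: "'i \<Rightarrow> 'a \<Rightarrow> complex ^ 'n" and f :: "('i \<Rightarrow> complex ^ 'n) \<Rightarrow> complex"
  assumes "I \<noteq> {}"
    and h: "\<And>r. r \<in> I \<Longrightarrow> iid_complex_gaussian_vector M (h r)" "indep_vars (\<lambda>_. borel) h I"
    and h': "\<And>r. r \<in> I \<Longrightarrow> iid_complex_gaussian_vector M (h' r)" "indep_vars (\<lambda>_. borel) h' I"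
    and f: "f \<in> borel_measurable (\<Pi>\<^sub>M r\<in>I. borel)"
  shows "expectation (\<lambda>\<omega>. f (\<lambda>r\<in>I. h r \<omega>)) = expectation (\<lambda>\<omega>. f (\<lambda>r\<in>I. h' r \<omega>))"
proof -
  have meas: "(\<lambda>\<omega>. \<lambda>r\<in>I. h r \<omega>) \<in> measurable M (\<Pi>\<^sub>M r\<in>I. borel)"
    "(\<lambda>\<omega>. \<lambda>r\<in>I. h' r \<omega>) \<in> measurable M (\<Pi>\<^sub>M r\<in>I. borel)"
    using h(1) h'(1) by (auto intro!: measurable_restrict gaussian_vector_measurable)
  have "distr M (\<Pi>\<^sub>M r\<in>I. borel) (\<lambda>\<omega>. \<lambda>r\<in>I. h r \<omega>) = (\<Pi>\<^sub>M r\<in>I. distr M borel (h r))"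
    by (rule indep_vars_iff_distr_eq_PiM'[THEN iffD1, OF \<open>I \<noteq> {}\<close> _ h(2)])
      (rule gaussian_vector_measurable[OF h(1)])
  also have "\<dots> = (\<Pi>\<^sub>M r\<in>I. distr M borel (h' r))"
    using h(1) h'(1) by (intro PiM_cong gaussian_vector_distr_eq) auto
  also have "\<dots> = distr M (\<Pi>\<^sub>M r\<in>I. borel) (\<lambda>\<omega>. \<lambda>r\<in>I. h' r \<omega>)"
    by (rule indep_vars_iff_distr_eq_PiM'[THEN iffD1, OF \<open>I \<noteq> {}\<close> _ h'(2), symmetric])
      (rule gaussian_vector_measurable[OF h'(1)])
  finally have "distr M (\<Pi>\<^sub>M r\<in>I. borel) (\<lambda>\<omega>. \<lambda>r\<in>I. h r \<omega>) = distr M (\<Pi>\<^sub>M r\<in>I. borel) (\<lambda>\<omega>. \<lambda>r\<in>I. h' r \<omega>)" .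
  then show ?thesis
    using integral_distr[OF meas(1) f] integral_distr[OF meas(2) f] by simp
qed

end

definition flip_sign :: "'n \<Rightarrow> complex ^ 'n \<Rightarrow> complex ^ 'n" where
  "flip_sign a v = (\<chi> i. if i = a then - v $ i else v $ i)"

lemma (in prob_space) gaussian_vector_flip_sign:
  assumes h: "iid_complex_gaussian_vector M h"
  shows "iid_complex_gaussian_vector M (\<lambda>\<omega>. flip_sign a (h \<omega>))"
  unfolding iid_complex_gaussian_vector_def
proof (intro conjI allI)
  show "std_complex_gaussian M (\<lambda>\<omega>. flip_sign a (h \<omega>) $ i)" for i
    using h std_complex_gaussian_uminus[of "\<lambda>\<omega>. h \<omega> $ i"]
    by (cases "i = a") (simp_all add: flip_sign_def iid_complex_gaussian_vector_def)
  have "indep_vars (\<lambda>_. borel) (\<lambda>i \<omega>. (if i = a then - (h \<omega> $ i) else h \<omega> $ i)) UNIV"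
    using h indep_vars_compose2[of "\<lambda>_. borel" "\<lambda>i \<omega>. h \<omega> $ i" UNIV "\<lambda>i z. if i = a then - z else z" "\<lambda>_. borel"]
    by (simp add: iid_complex_gaussian_vector_def)
  then show "indep_vars (\<lambda>_. borel) (\<lambda>i \<omega>. flip_sign a (h \<omega>) $ i) UNIV"
    by (simp add: flip_sign_def)
qed

text \<open>Conjugation by a diagonal matrix of square roots of 1 commutes with matrix powers, since
  the inner signs meet in pairs and cancel; hence it commutes with the exponential series.\<close>

lemma exp_entry_conj_sign:
  assumes X: "\<And>i j. Y $ i $ j = \<epsilon> i * \<epsilon> j * X $ i $ j" and \<epsilon>: "\<And>i. \<epsilon> i * \<epsilon> i = 1"
  shows "exp_entry Y i j z = \<epsilon> i * \<epsilon> j * exp_entry X i j z"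
proof -
  have pow: "matpow Y k $ i $ j = \<epsilon> i * \<epsilon> j * matpow X k $ i $ j" for k i j
  proof (induction k arbitrary: i j)
    case 0
    then show ?case by (simp add: mat_def \<epsilon>)
  next
    case (Suc k)
    have "\<epsilon> i * \<epsilon> l * X $ i $ l * (\<epsilon> l * \<epsilon> j * matpow X k $ l $ j) =
        (\<epsilon> l * \<epsilon> l) * (\<epsilon> i * \<epsilon> j * (X $ i $ l * matpow X k $ l $ j))" for l
      by (simp only: mult_ac)
    then show ?case
      unfolding matpow_Suc_entry Suc X by (simp only: \<epsilon> sum_distrib_left mult_1_left)
  qed
  have "exp_entry Y i j z = (\<Sum>k. \<epsilon> i * \<epsilon> j * (expcoef X i j k * z ^ k))"
    by (simp add: exp_entry_def expcoef_def pow mult_ac)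
  also have "\<dots> = \<epsilon> i * \<epsilon> j * exp_entry X i j z"
    unfolding exp_entry_def by (rule suminf_mult[OF summable_expcoef])
  finally show ?thesis .
qed

section \<open>Sums of Wishart matrices\<close>

lemma complex_wishart_entry:
  "complex_wishart S h \<omega> $ i $ j =
    complex_of_real (sqrt (S $ i $ i) * sqrt (S $ j $ j)) * (h \<omega> $ i * cnj (h \<omega> $ j))"
proof -
  have "complex_wishart S h \<omega> $ i $ j = (\<Sum>k\<in>UNIV. (\<Sum>l\<in>UNIV.
      (if i = l then complex_of_real (sqrt (S $ i $ i)) * (h \<omega> $ l * cnj (h \<omega> $ k)) else 0)) *
      (if k = j then complex_of_real (sqrt (S $ k $ k)) else 0))"
    unfolding complex_wishart_def matrix_matrix_mult_def vec_lambda_beta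
    by (intro sum.cong refl arg_cong2[of _ _ _ _ "(*)"])
      (simp_all add: cmatrix_def map_matrix_def diag_sqrt_def outer_self_def)
  also have "\<dots> = (\<Sum>k\<in>UNIV. if k = j then complex_of_real (sqrt (S $ i $ i)) * (h \<omega> $ i * cnj (h \<omega> $ k)) *
      complex_of_real (sqrt (S $ k $ k)) else 0)"
    by (intro sum.cong refl) simp
  also have "\<dots> = complex_of_real (sqrt (S $ i $ i) * sqrt (S $ j $ j)) * (h \<omega> $ i * cnj (h \<omega> $ j))"
    by simp
  finally show ?thesis .
qed

text \<open>Flipping coordinate \<open>i\<close> of every vector preserves the joint law but changes
  the sign of the entry (i, j), so the expectation equals its own negative.\<close>

lemma (in prob_space) wishart_sum_exp_offdiag:
  fixes h :: "'i \<Rightarrow> 'a \<Rightarrow> complex ^ 'n"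
  assumes "I \<noteq> {}"
    and h: "\<And>r. r \<in> I \<Longrightarrow> iid_complex_gaussian_vector M (h r)" "indep_vars (\<lambda>_. borel) h I"
    and "i \<noteq> j"
  shows "expectation (\<lambda>\<omega>. exp_entry (\<Sum>r\<in>I. complex_wishart (S r) (h r) \<omega>) i j z) = 0"
proof -
  \<comment> \<open>The sum as a deterministic function on the product space, obtained by using the
    coordinate projections as the vectors.\<close>
  define W where "W v = (\<Sum>r\<in>I. complex_wishart (S r) (\<lambda>v. v r) v)" for v :: "'i \<Rightarrow> complex ^ 'n"
  define h' where "h' r \<omega> = flip_sign i (h r \<omega>)" for r \<omega>
  have W: "W (\<lambda>r\<in>I. g r \<omega>) = (\<Sum>r\<in>I. complex_wishart (S r) (g r) \<omega>)" for g :: "'i \<Rightarrow> 'a \<Rightarrow> complex ^ 'n" and \<omega>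
    by (simp add: W_def vec_eq_iff complex_wishart_entry)
  have [measurable]: "(\<lambda>v. v $ i) \<in> borel_measurable borel" for i :: 'n
    by (intro borel_measurable_continuous_onI continuous_intros)
  have measW: "(\<lambda>v. exp_entry (W v) i j z) \<in> borel_measurable (\<Pi>\<^sub>M r\<in>I. borel)"
  proof (rule exp_entry_measurable)
    have [measurable]: "(\<lambda>v. v r $ a) \<in> borel_measurable (\<Pi>\<^sub>M r\<in>I. borel)" if "r \<in> I" for r and a :: 'n
      by (rule measurable_compose[OF measurable_component_singleton[OF that]]) measurable
    then show "(\<lambda>v. W v $ a $ b) \<in> borel_measurable (\<Pi>\<^sub>M r\<in>I. borel)" for a b
      unfolding W_def sum_component complex_wishart_entry
      by (intro borel_measurable_sum borel_measurable_times borel_measurable_const borel_measurable_cnj)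
  qed
  have flip_meas: "flip_sign i \<in> borel_measurable borel"
    by (intro borel_measurable_vec) (simp add: flip_sign_def)
  have "expectation (\<lambda>\<omega>. exp_entry (W (\<lambda>r\<in>I. h r \<omega>)) i j z) = expectation (\<lambda>\<omega>. exp_entry (W (\<lambda>r\<in>I. h' r \<omega>)) i j z)"
    unfolding h'_def
    by (rule gaussian_family_expectation_eq[OF \<open>I \<noteq> {}\<close> h gaussian_vector_flip_sign[OF h(1)] _ measW])
      (auto intro: indep_vars_compose2[OF h(2)] flip_meas)
  moreover have "exp_entry (W (\<lambda>r\<in>I. h' r \<omega>)) i j z = - exp_entry (W (\<lambda>r\<in>I. h r \<omega>)) i j z" for \<omega>
  proof -
    have "exp_entry (W (\<lambda>r\<in>I. h' r \<omega>)) i j z =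
        (\<lambda>a. if a = i then - 1 else 1) i * (\<lambda>a. if a = i then - 1 else 1) j * exp_entry (W (\<lambda>r\<in>I. h r \<omega>)) i j z"
      by (rule exp_entry_conj_sign)
        (unfold W, auto simp: h'_def complex_wishart_entry flip_sign_def sum_distrib_left simp flip: sum_negf)
    with \<open>i \<noteq> j\<close> show ?thesis by simp
  qed
  ultimately have "expectation (\<lambda>\<omega>. exp_entry (W (\<lambda>r\<in>I. h r \<omega>)) i j z) =
      - expectation (\<lambda>\<omega>. exp_entry (W (\<lambda>r\<in>I. h r \<omega>)) i j z)"
    by simp
  then show ?thesis
    by (simp add: W)
qed

section \<open>Centred Wishart entries and their moments\<close>

definition centred_wishart :: "real ^ 'n ^ 'n \<Rightarrow> ('a \<Rightarrow> complex ^ 'n) \<Rightarrow> 'n \<Rightarrow> 'n \<Rightarrow> 'a \<Rightarrow> complex" where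
  "centred_wishart S h a b \<omega> = complex_wishart S h \<omega> $ a $ b - complex_of_real (if a = b then S $ a $ a else 0)"

text \<open>This is E |V_ab|^2, because V_ba is the conjugate of V_ab.\<close>

definition wishart_covariance :: "'a measure \<Rightarrow> real ^ 'n ^ 'n \<Rightarrow> ('a \<Rightarrow> complex ^ 'n) \<Rightarrow> 'n \<Rightarrow> 'n \<Rightarrow> complex" where
  "wishart_covariance M S h a b =
    integral\<^sup>L M (\<lambda>\<omega>. centred_wishart S h a b \<omega> * centred_wishart S h b a \<omega>)"

text \<open>The diagonal entry of E V^3. It is never evaluated: being additive over the summands, it
  cancels in the residual.\<close>

definition wishart_third_moment :: "'a measure \<Rightarrow> real ^ 'n ^ 'n \<Rightarrow> ('a \<Rightarrow> complex ^ 'n) \<Rightarrow> 'n \<Rightarrow> complex" where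
  "wishart_third_moment M S h a = (\<Sum>b\<in>UNIV. \<Sum>c\<in>UNIV.
    integral\<^sup>L M (\<lambda>\<omega>. centred_wishart S h a b \<omega> * centred_wishart S h b c \<omega> * centred_wishart S h c a \<omega>))"

text \<open>Exhibits the entry as a fixed function of the vector, so that independence of the
  vectors passes to the entries.\<close>

lemma centred_wishart_comp:
  "centred_wishart S (\<lambda>v. v) a b (h \<omega>) = centred_wishart S h a b \<omega>"
  by (simp add: centred_wishart_def complex_wishart_entry)

lemma centred_wishart_measurable: "centred_wishart S (\<lambda>v. v) a b \<in> borel_measurable borel"
proof -
  have comp: "(\<lambda>v :: complex ^ 'n. v $ a) \<in> borel_measurable borel" for a
    by (intro borel_measurable_continuous_onI continuous_intros)
  show ?thesis
    unfolding centred_wishart_def[abs_def] complex_wishart_entry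
    by (intro borel_measurable_diff borel_measurable_times borel_measurable_const borel_measurable_cnj comp)
qed

context prob_space
begin

lemma complex_wishart_finite_moments:
  assumes "iid_complex_gaussian_vector M h"
  shows "finite_moments M (\<lambda>\<omega>. complex_wishart S h \<omega> $ a $ b)"
  unfolding complex_wishart_entry using assms
  by (intro finite_moments_mult finite_moments_const finite_moments_cnj gaussian_vector_finite_moments)

lemma centred_wishart_finite_moments:
  assumes "iid_complex_gaussian_vector M h"
  shows "finite_moments M (centred_wishart S h a b)"
proof -
  have "finite_moments M (\<lambda>\<omega>. complex_wishart S h \<omega> $ a $ b + - complex_of_real (if a = b then S $ a $ a else 0))"
    by (intro finite_moments_add complex_wishart_finite_moments[OF assms] finite_moments_const)
  then show ?thesis
    by (simp add: centred_wishart_def[abs_def])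
qed

lemma centred_wishart_expectation:
  assumes h: "iid_complex_gaussian_vector M h" and S: "diagonal_covariance S"
  shows "expectation (centred_wishart S h a b) = 0"
proof -
  have "expectation (\<lambda>\<omega>. complex_wishart S h \<omega> $ a $ b) = complex_of_real (if a = b then S $ a $ a else 0)"
    using S unfolding complex_wishart_entry
    by (simp add: gaussian_vector_second_moment[OF h] diagonal_covariance_def flip: of_real_mult)
  then show ?thesis
    using finite_moments_integrable[OF complex_wishart_finite_moments[OF h]]
    by (simp add: centred_wishart_def[abs_def] prob_space)
qed

text \<open>Off the diagonal nothing is subtracted, and the product is S_aa S_bb |h_a|^2 |h_b|^2
  with a fourth moment equal to 1.\<close>

lemma wishart_covariance_offdiag:
  assumes h: "iid_complex_gaussian_vector M h" and S: "diagonal_covariance S" and "a \<noteq> b"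
  shows "wishart_covariance M S h a b = complex_of_real (S $ a $ a * S $ b $ b)"
proof -
  have sq: "sqrt (S $ a $ a) * sqrt (S $ b $ b) * (sqrt (S $ b $ b) * sqrt (S $ a $ a)) = S $ a $ a * S $ b $ b"
  proof -
    have "sqrt (S $ a $ a) * sqrt (S $ b $ b) * (sqrt (S $ b $ b) * sqrt (S $ a $ a)) =
        (sqrt (S $ a $ a) * sqrt (S $ a $ a)) * (sqrt (S $ b $ b) * sqrt (S $ b $ b))"
      by (simp only: mult_ac)
    also have "\<dots> = S $ a $ a * S $ b $ b"
      using S by (simp add: diagonal_covariance_def)
    finally show ?thesis .
  qed
  have "centred_wishart S h a b \<omega> * centred_wishart S h b a \<omega> = complex_of_real (S $ a $ a * S $ b $ b) *
      ((h \<omega> $ a * cnj (h \<omega> $ a)) * (h \<omega> $ b * cnj (h \<omega> $ b)))" for \<omega>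
  proof -
    have "centred_wishart S h a b \<omega> * centred_wishart S h b a \<omega> =
        complex_of_real (sqrt (S $ a $ a) * sqrt (S $ b $ b) * (sqrt (S $ b $ b) * sqrt (S $ a $ a))) *
        ((h \<omega> $ a * cnj (h \<omega> $ a)) * (h \<omega> $ b * cnj (h \<omega> $ b)))"
      using \<open>a \<noteq> b\<close>
      by (simp only: centred_wishart_def complex_wishart_entry of_real_mult if_False not_sym[OF \<open>a \<noteq> b\<close>]
          of_real_0 diff_zero mult_ac)
    then show ?thesis
      by (simp only: sq)
  qed
  then show ?thesis
    by (simp add: wishart_covariance_def gaussian_vector_fourth_moment[OF h \<open>a \<noteq> b\<close>])
qed

end

section \<open>Moments of a sum of independent Wishart matrices\<close>

lemma sum_triple_product:
  fixes f g k :: "'b \<Rightarrow> 'c :: comm_ring"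
  shows "sum f I * sum g I * sum k I = (\<Sum>r\<in>I. \<Sum>s\<in>I. \<Sum>u\<in>I. f r * g s * k u)"
proof -
  have "sum f I * sum g I * sum k I = sum f I * (\<Sum>s\<in>I. \<Sum>u\<in>I. g s * k u)"
    by (simp only: mult.assoc sum_product[of g I k I])
  also have "\<dots> = (\<Sum>r\<in>I. \<Sum>s\<in>I. f r * (\<Sum>u\<in>I. g s * k u))"
    by (rule sum_product)
  finally show ?thesis
    by (simp only: sum_distrib_left mult.assoc)
qed

text \<open>The index set is a parameter so that one cumulant formula serves both the full sum and,
  with a one-element set, each single summand.\<close>

locale wishart_family = prob_space M for M :: "'a measure" +
  fixes I :: "'i set" and S :: "'i \<Rightarrow> real ^ 'n ^ 'n" and h :: "'i \<Rightarrow> 'a \<Rightarrow> complex ^ 'n"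
  assumes finite_I: "finite I" and nonempty: "I \<noteq> {}"
    and diagonal: "r \<in> I \<Longrightarrow> diagonal_covariance (S r)"
    and gaussian: "r \<in> I \<Longrightarrow> iid_complex_gaussian_vector M (h r)"
    and indep: "indep_vars (\<lambda>_. borel) h I"
begin

abbreviation "W \<omega> \<equiv> \<Sum>r\<in>I. complex_wishart (S r) (h r) \<omega>"

definition mean :: "'n \<Rightarrow> complex" where
  "mean a = (\<Sum>r\<in>I. complex_of_real (S r $ a $ a))"

abbreviation "V r \<equiv> centred_wishart (S r) (h r)"

definition U :: "'n \<Rightarrow> 'n \<Rightarrow> 'a \<Rightarrow> complex" where
  "U a b \<omega> = (\<Sum>r\<in>I. V r a b \<omega>)"

lemma W_entry: "W \<omega> $ a $ b = (if a = b then mean a else 0) + U a b \<omega>"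
  by (simp add: U_def mean_def centred_wishart_def sum_subtractf)

lemmas V_moments = centred_wishart_finite_moments[OF gaussian]

lemma U_moments: "finite_moments M (U a b)"
  unfolding U_def[abs_def] by (intro finite_moments_sum V_moments)

lemma U_expectation: "expectation (U a b) = 0"
  unfolding U_def[abs_def]
  by (subst Bochner_Integration.integral_sum)
    (simp_all add: finite_moments_integrable V_moments centred_wishart_expectation gaussian diagonal)

lemma V_triple_zero:
  assumes "r \<in> I" "s \<in> I" "u \<in> I" "r \<noteq> s" "r \<noteq> u"
  shows "expectation (\<lambda>\<omega>. V r a b \<omega> * V s c d \<omega> * V u e f \<omega>) = 0"
proof -
  note [simp] = centred_wishart_comp[of _ _ _ "h r"] centred_wishart_comp[of _ _ _ "h s"]
    centred_wishart_comp[of _ _ _ "h u"]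
  show ?thesis
    using assms indep_triple_expectation_zero[OF indep assms centred_wishart_measurable
        centred_wishart_measurable centred_wishart_measurable, of "S r" a b "S s" c d "S u" e f]
    by (simp add: V_moments centred_wishart_expectation gaussian diagonal)
qed

lemma V_pair_zero:
  assumes "r \<in> I" "s \<in> I" "r \<noteq> s"
  shows "expectation (\<lambda>\<omega>. V r a b \<omega> * V s c d \<omega>) = 0"
proof -
  note [simp] = centred_wishart_comp[of _ _ _ "h r"] centred_wishart_comp[of _ _ _ "h s"]
  show ?thesis
    using assms indep_triple_expectation_zero[OF indep assms(1,2,2,3,3) centred_wishart_measurable
        centred_wishart_measurable borel_measurable_const, of "S r" a b "S s" c d 1]
    by (simp add: V_moments centred_wishart_expectation gaussian diagonal finite_moments_const)
qed

lemma U_pair: "expectation (\<lambda>\<omega>. U a b \<omega> * U b a \<omega>) = (\<Sum>r\<in>I. wishart_covariance M (S r) (h r) a b)"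
proof -
  have "expectation (\<lambda>\<omega>. U a b \<omega> * U b a \<omega>) = expectation (\<lambda>\<omega>. \<Sum>r\<in>I. \<Sum>s\<in>I. V r a b \<omega> * V s b a \<omega>)"
    by (simp add: U_def sum_product)
  also have "\<dots> = (\<Sum>r\<in>I. \<Sum>s\<in>I. expectation (\<lambda>\<omega>. V r a b \<omega> * V s b a \<omega>))"
    by (subst Bochner_Integration.integral_sum; (intro Bochner_Integration.integrable_sum sum.cong refl Bochner_Integration.integral_sum)?;
        intro finite_moments_integrable finite_moments_mult V_moments)
  also have "\<dots> = (\<Sum>r\<in>I. \<Sum>s\<in>I. if s = r then wishart_covariance M (S r) (h r) a b else 0)"
    by (intro sum.cong refl) (auto simp: V_pair_zero wishart_covariance_def)
  also have "\<dots> = (\<Sum>r\<in>I. wishart_covariance M (S r) (h r) a b)"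
    using finite_I by simp
  finally show ?thesis .
qed

text \<open>Third moments of independent centred matrices add up: after expanding the product, only
  the terms with three equal indices survive.\<close>

lemma U_triple: "(\<Sum>b\<in>UNIV. \<Sum>c\<in>UNIV. expectation (\<lambda>\<omega>. U a b \<omega> * U b c \<omega> * U c a \<omega>)) =
    (\<Sum>r\<in>I. wishart_third_moment M (S r) (h r) a)"
proof -
  let ?E = "\<lambda>r s u b c. expectation (\<lambda>\<omega>. V r a b \<omega> * V s b c \<omega> * V u c a \<omega>)"
  have "expectation (\<lambda>\<omega>. U a b \<omega> * U b c \<omega> * U c a \<omega>) = (\<Sum>r\<in>I. ?E r r r b c)" for b c
  proof -
    have "expectation (\<lambda>\<omega>. U a b \<omega> * U b c \<omega> * U c a \<omega>) =
        expectation (\<lambda>\<omega>. \<Sum>r\<in>I. \<Sum>s\<in>I. \<Sum>u\<in>I. V r a b \<omega> * V s b c \<omega> * V u c a \<omega>)"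
      by (simp only: U_def sum_triple_product)
    also have "\<dots> = (\<Sum>r\<in>I. \<Sum>s\<in>I. \<Sum>u\<in>I. ?E r s u b c)"
      by (subst Bochner_Integration.integral_sum,
          (intro Bochner_Integration.integrable_sum finite_moments_integrable finite_moments_mult V_moments; assumption),
          intro sum.cong refl,
          subst Bochner_Integration.integral_sum,
          (intro Bochner_Integration.integrable_sum finite_moments_integrable finite_moments_mult V_moments; assumption),
          intro sum.cong refl Bochner_Integration.integral_sum finite_moments_integrable finite_moments_mult V_moments; assumption)
    also have "\<dots> = (\<Sum>r\<in>I. \<Sum>s\<in>I. \<Sum>u\<in>I. if u = r then if s = r then ?E r r r b c else 0 else 0)"
    proof (intro sum.cong refl)
      fix r s u assume rsu: "r \<in> I" "s \<in> I" "u \<in> I"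
      \<comment> \<open>Three indices that are not all equal contain one that differs from the other
        two. Its scalar factor is moved to the front and kills the expectation.\<close>
      consider "s = r" "u = r" | "r \<noteq> s" "r \<noteq> u" | "s \<noteq> r" "s \<noteq> u" | "u \<noteq> r" "u \<noteq> s"
        by blast
      then show "?E r s u b c = (if u = r then if s = r then ?E r r r b c else 0 else 0)"
      proof cases
        case 2
        then show ?thesis using V_triple_zero[of r s u a b b c c a] rsu by simp
      next
        case 3
        then show ?thesis using V_triple_zero[of s r u b c a b c a] rsu by (simp add: mult_ac)
      next
        case 4
        then show ?thesis using V_triple_zero[of u r s c a a b b c] rsu by (simp add: mult_ac)
      qed simp
    qed
    also have "\<dots> = (\<Sum>r\<in>I. ?E r r r b c)"
      using finite_I by simp
    finally show ?thesis .
  qed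
  then show ?thesis
    unfolding wishart_third_moment_def by (simp add: sum.swap[of _ I])
qed

lemma expectation_U_square:
  "expectation (\<lambda>\<omega>. \<Sum>b\<in>UNIV. f b * (U a b \<omega> * U b a \<omega>)) =
    (\<Sum>b\<in>UNIV. f b * (\<Sum>r\<in>I. wishart_covariance M (S r) (h r) a b))"
  by (simp add: Bochner_Integration.integral_sum finite_moments_integrable finite_moments_mult U_moments U_pair)

lemma moment_1: "mat_moment M 1 W a = mean a"
proof -
  have "mat_moment M 1 W a = expectation (\<lambda>\<omega>. mean a + U a a \<omega>)"
    unfolding mat_moment_def One_nat_def matpow_one W_entry by simp
  then show ?thesis
    using finite_moments_integrable[OF U_moments] U_expectation by (simp add: prob_space)
qed

text \<open>Entry (a, b) of D^2 + D U + U D + U^2, where D is the diagonal matrix of the values of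
  \<open>mean\<close>.\<close>

lemma W_square_entry:
  "matpow (W \<omega>) 2 $ a $ b = (if a = b then (mean a)\<^sup>2 else 0) + (mean a + mean b) * U a b \<omega> +
    (\<Sum>c\<in>UNIV. U a c \<omega> * U c b \<omega>)"
proof -
  have "matpow (W \<omega>) 2 $ a $ b = (\<Sum>c\<in>UNIV. W \<omega> $ a $ c * W \<omega> $ c $ b)"
    by (simp only: numeral_2_eq_2 matpow_Suc_entry matpow_one)
  also have "\<dots> = (\<Sum>c\<in>UNIV. (if c = a then mean a * ((if a = b then mean a else 0) + U a b \<omega>) else 0) +
      (if c = b then U a b \<omega> * mean b else 0) + U a c \<omega> * U c b \<omega>)"
    unfolding W_entry by (intro sum.cong refl) (auto simp: algebra_simps)
  also have "\<dots> = mean a * ((if a = b then mean a else 0) + U a b \<omega>) + U a b \<omega> * mean b +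
      (\<Sum>c\<in>UNIV. U a c \<omega> * U c b \<omega>)"
    by (simp add: sum.distrib)
  finally show ?thesis
    by (simp add: algebra_simps power2_eq_square)
qed

lemma moment_2:
  "mat_moment M 2 W a = (mean a)\<^sup>2 + (\<Sum>b\<in>UNIV. \<Sum>r\<in>I. wishart_covariance M (S r) (h r) a b)"
proof -
  have "mat_moment M 2 W a = expectation (\<lambda>\<omega>. (mean a)\<^sup>2 + (mean a + mean a) * U a a \<omega> +
      (\<Sum>c\<in>UNIV. 1 * (U a c \<omega> * U c a \<omega>)))"
    unfolding mat_moment_def W_square_entry by simp
  also have "\<dots> = (mean a)\<^sup>2 + (mean a + mean a) * expectation (U a a) +
      expectation (\<lambda>\<omega>. \<Sum>c\<in>UNIV. 1 * (U a c \<omega> * U c a \<omega>))"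
    by (subst Bochner_Integration.integral_add, (intro finite_moments_integrable finite_moments_add finite_moments_mult finite_moments_sum finite_moments_const U_moments)+)+
      (simp add: prob_space)
  finally show ?thesis
    by (simp only: expectation_U_square U_expectation) simp
qed

text \<open>Expansion of (D + U)^3 with D diagonal. The quadratic terms D U U, U D U and U U D carry
  the weights \<open>mean a\<close>, \<open>mean b\<close> and \<open>mean a\<close>; the middle
  one, where D does not commute past U, is the source of the residual.\<close>

lemma W_cube_entry:
  "matpow (W \<omega>) 3 $ a $ a = (mean a) ^ 3 + 3 * (mean a)\<^sup>2 * U a a \<omega> +
    (\<Sum>b\<in>UNIV. (2 * mean a + mean b) * (U a b \<omega> * U b a \<omega>)) +
    (\<Sum>b\<in>UNIV. \<Sum>c\<in>UNIV. U a b \<omega> * U b c \<omega> * U c a \<omega>)"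
proof -
  let ?Q = "\<lambda>b. \<Sum>c\<in>UNIV. U b c \<omega> * U c a \<omega>"
  have "matpow (W \<omega>) 3 $ a $ a = (\<Sum>b\<in>UNIV. W \<omega> $ a $ b * matpow (W \<omega>) 2 $ b $ a)"
    unfolding numeral_3_eq_3 numeral_2_eq_2 by (rule matpow_Suc_entry)
  also have "\<dots> = (\<Sum>b\<in>UNIV. (if b = a then mean a * ((mean a)\<^sup>2 + (mean a + mean a) * U a a \<omega> + ?Q a) + U a a \<omega> * (mean a)\<^sup>2 else 0) +
      (mean a + mean b) * (U a b \<omega> * U b a \<omega>) + U a b \<omega> * ?Q b)"
    unfolding W_entry W_square_entry by (intro sum.cong refl) (auto simp: algebra_simps)
  also have "\<dots> = mean a * ((mean a)\<^sup>2 + (mean a + mean a) * U a a \<omega> + ?Q a) + U a a \<omega> * (mean a)\<^sup>2 +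
      (\<Sum>b\<in>UNIV. (mean a + mean b) * (U a b \<omega> * U b a \<omega>)) + (\<Sum>b\<in>UNIV. U a b \<omega> * ?Q b)"
    by (simp add: sum.distrib)
  also have "\<dots> = (mean a) ^ 3 + 3 * (mean a)\<^sup>2 * U a a \<omega> +
      (mean a * ?Q a + (\<Sum>b\<in>UNIV. (mean a + mean b) * (U a b \<omega> * U b a \<omega>))) + (\<Sum>b\<in>UNIV. U a b \<omega> * ?Q b)"
    by (simp add: algebra_simps power2_eq_square power3_eq_cube)
  also have "mean a * ?Q a + (\<Sum>b\<in>UNIV. (mean a + mean b) * (U a b \<omega> * U b a \<omega>)) =
      (\<Sum>b\<in>UNIV. (2 * mean a + mean b) * (U a b \<omega> * U b a \<omega>))"
    by (simp add: sum_distrib_left algebra_simps flip: sum.distrib)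
  finally show ?thesis
    by (simp only: sum_distrib_left mult.assoc)
qed

lemma moment_3:
  "mat_moment M 3 W a = (mean a) ^ 3 +
    (\<Sum>b\<in>UNIV. (2 * mean a + mean b) * (\<Sum>r\<in>I. wishart_covariance M (S r) (h r) a b)) +
    (\<Sum>r\<in>I. wishart_third_moment M (S r) (h r) a)"
proof -
  have "mat_moment M 3 W a = (mean a) ^ 3 + 3 * (mean a)\<^sup>2 * expectation (U a a) +
      expectation (\<lambda>\<omega>. \<Sum>b\<in>UNIV. (2 * mean a + mean b) * (U a b \<omega> * U b a \<omega>)) +
      expectation (\<lambda>\<omega>. \<Sum>b\<in>UNIV. \<Sum>c\<in>UNIV. U a b \<omega> * U b c \<omega> * U c a \<omega>)"
    unfolding mat_moment_def W_cube_entry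
    by (subst Bochner_Integration.integral_add, (intro finite_moments_integrable finite_moments_add finite_moments_mult finite_moments_sum finite_moments_const U_moments)+)+
      (simp add: prob_space)
  also have "expectation (\<lambda>\<omega>. \<Sum>b\<in>UNIV. \<Sum>c\<in>UNIV. U a b \<omega> * U b c \<omega> * U c a \<omega>) =
      (\<Sum>b\<in>UNIV. \<Sum>c\<in>UNIV. expectation (\<lambda>\<omega>. U a b \<omega> * U b c \<omega> * U c a \<omega>))"
    by (simp add: Bochner_Integration.integral_sum finite_moments_integrable finite_moments_sum finite_moments_mult U_moments)
  finally show ?thesis
    by (simp only: expectation_U_square U_expectation U_triple) simp
qed

section \<open>Cumulants of the sum and their residuals\<close>

lemma W_cumulants:
  shows cumulant_1: "mat_cumulant M 1 W = diag_matrix mean"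
    and cumulant_2: "mat_cumulant M 2 W =
      diag_matrix (\<lambda>a. \<Sum>r\<in>I. \<Sum>b\<in>UNIV. wishart_covariance M (S r) (h r) a b)"
    and cumulant_3: "mat_cumulant M 3 W = diag_matrix (\<lambda>a. (\<Sum>r\<in>I. wishart_third_moment M (S r) (h r) a) +
      (\<Sum>r\<in>I. \<Sum>b\<in>UNIV. (mean b - mean a) * complex_of_real (S r $ a $ a * S r $ b $ b)))"
proof -
  have mom: "finite_moments M (\<lambda>\<omega>. W \<omega> $ a $ b)" for a b
    unfolding W_entry by (intro finite_moments_add finite_moments_const U_moments)
  have herm: "W \<omega> $ a $ b = cnj (W \<omega> $ b $ a)" for \<omega> a b
    by (simp add: complex_wishart_entry mult_ac)
  have off: "expectation (\<lambda>\<omega>. exp_entry (W \<omega>) i j (complex_of_real t)) = 0" if "i \<noteq> j" for t i j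
    using wishart_sum_exp_offdiag[OF nonempty gaussian indep that] .
  have K: "mat_cumulant M 1 W = diag_matrix (mat_moment M 1 W)"
      "mat_cumulant M 2 W = diag_matrix (\<lambda>i. mat_moment M 2 W i - (mat_moment M 1 W i)\<^sup>2)"
      "mat_cumulant M 3 W = diag_matrix (\<lambda>i. mat_moment M 3 W i
        - 3 * mat_moment M 1 W i * mat_moment M 2 W i + 2 * mat_moment M 1 W i ^ 3)"
    by (rule mat_cumulant_1 mat_cumulant_2 mat_cumulant_3; rule mom herm off; assumption)+
  have "mat_moment M 1 W = mean"
    by (rule ext) (rule moment_1)
  with K(1) show "mat_cumulant M 1 W = diag_matrix mean"
    by simp
  show "mat_cumulant M 2 W =
      diag_matrix (\<lambda>a. \<Sum>r\<in>I. \<Sum>b\<in>UNIV. wishart_covariance M (S r) (h r) a b)"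
    by (simp only: K moment_1 moment_2 add_diff_cancel_left') (subst sum.swap, rule)
  \<comment> \<open>The quadratic part of m_3 - 3 m_1 m_2; the cubes of the mean cancel separately,
    since 1 - 3 + 2 = 0.\<close>
  have "(\<Sum>b\<in>UNIV. (2 * mean a + mean b) * q b) - 3 * mean a * (\<Sum>b\<in>UNIV. q b) =
      (\<Sum>b\<in>UNIV. (mean b - mean a) * q b)" for a q
    by (simp only: sum_distrib_left flip: sum_subtractf) (simp add: algebra_simps)
  note alg = this[of a "\<lambda>b. \<Sum>r\<in>I. wishart_covariance M (S r) (h r) a b" for a]
  have "mat_moment M 3 W a - 3 * mat_moment M 1 W a * mat_moment M 2 W a + 2 * mat_moment M 1 W a ^ 3 =
     (\<Sum>r\<in>I. wishart_third_moment M (S r) (h r) a) +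
      (\<Sum>r\<in>I. \<Sum>b\<in>UNIV. (mean b - mean a) * complex_of_real (S r $ a $ a * S r $ b $ b))" for a
  proof -
    have "mat_moment M 3 W a - 3 * mat_moment M 1 W a * mat_moment M 2 W a + 2 * mat_moment M 1 W a ^ 3 =
        (\<Sum>r\<in>I. wishart_third_moment M (S r) (h r) a) +
        ((\<Sum>b\<in>UNIV. (2 * mean a + mean b) * (\<Sum>r\<in>I. wishart_covariance M (S r) (h r) a b)) -
          3 * mean a * (\<Sum>b\<in>UNIV. \<Sum>r\<in>I. wishart_covariance M (S r) (h r) a b))"
      unfolding moment_1 moment_2 moment_3
      by (simp only: power2_eq_square power3_eq_cube distrib_left) (simp add: algebra_simps)
    also have "\<dots> = (\<Sum>r\<in>I. wishart_third_moment M (S r) (h r) a) +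
        (\<Sum>r\<in>I. \<Sum>b\<in>UNIV. (mean b - mean a) * wishart_covariance M (S r) (h r) a b)"
      unfolding alg unfolding sum_distrib_left by (subst sum.swap) rule
    \<comment> \<open>The term b = a has weight 0 on both sides, so the off-diagonal value of the
      covariance may be inserted for every \<open>b\<close>.\<close>
    also have "(\<Sum>r\<in>I. \<Sum>b\<in>UNIV. (mean b - mean a) * wishart_covariance M (S r) (h r) a b) =
        (\<Sum>r\<in>I. \<Sum>b\<in>UNIV. (mean b - mean a) * complex_of_real (S r $ a $ a * S r $ b $ b))"
      using wishart_covariance_offdiag[OF gaussian diagonal]
      by (intro sum.cong refl) (metis cancel_comm_monoid_add_class.diff_cancel mult_zero_left)
    finally show ?thesis .
  qed
  then show "mat_cumulant M 3 W = diag_matrix (\<lambda>a. (\<Sum>r\<in>I. wishart_third_moment M (S r) (h r) a) +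
      (\<Sum>r\<in>I. \<Sum>b\<in>UNIV. (mean b - mean a) * complex_of_real (S r $ a $ a * S r $ b $ b)))"
    by (simp add: K)
qed

lemma singleton_family: "r \<in> I \<Longrightarrow> wishart_family M {r} S h"
  using diagonal gaussian indep_vars_subset[OF indep, of "{r}"]
  by unfold_locales auto

text \<open>The first two cumulants are sums over \<open>r\<close> of terms that involve only the
  summand \<open>r\<close>, and the same formulas hold for one-element families.\<close>

lemma residual_1: "mat_cumulant M 1 W - (\<Sum>r\<in>I. mat_cumulant M 1 (complex_wishart (S r) (h r))) = 0"
  using wishart_family.cumulant_1[OF singleton_family]
  by (simp add: cumulant_1 vec_eq_iff diag_matrix_entry mean_def wishart_family.mean_def[OF singleton_family]
      del: One_nat_def)

lemma residual_2: "mat_cumulant M 2 W - (\<Sum>r\<in>I. mat_cumulant M 2 (complex_wishart (S r) (h r))) = 0"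
  using wishart_family.cumulant_2[OF singleton_family]
  by (simp add: cumulant_2 vec_eq_iff diag_matrix_entry)

text \<open>The third moments cancel. What remains pairs the variances of summand \<open>r\<close>
  with the means of summand \<open>s\<close>; the single cumulants remove exactly the pairs with r =
  s.\<close>

lemma residual_3:
  "mat_cumulant M 3 W - (\<Sum>r\<in>I. mat_cumulant M 3 (complex_wishart (S r) (h r))) =
    diag_matrix (\<lambda>a. \<Sum>(r, s)\<in>{(r, s). r \<in> I \<and> s \<in> I \<and> r \<noteq> s}.
      complex_of_real (\<Sum>b\<in>UNIV. (S s $ b $ b - S s $ a $ a) * (S r $ a $ a * S r $ b $ b)))"
proof -
  define g where "g a r s = complex_of_real (\<Sum>b\<in>UNIV. (S s $ b $ b - S s $ a $ a) * (S r $ a $ a * S r $ b $ b))" for a r s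
  have "(\<Sum>b\<in>UNIV. (mean b - mean a) * complex_of_real (S r $ a $ a * S r $ b $ b)) = (\<Sum>s\<in>I. g a r s)" for a r
  proof -
    have "(\<Sum>b\<in>UNIV. (mean b - mean a) * complex_of_real (S r $ a $ a * S r $ b $ b)) =
        (\<Sum>b\<in>UNIV. \<Sum>s\<in>I. complex_of_real ((S s $ b $ b - S s $ a $ a) * (S r $ a $ a * S r $ b $ b)))"
      by (simp only: mean_def of_real_mult of_real_diff flip: sum_subtractf sum_distrib_right)
    also have "\<dots> = (\<Sum>s\<in>I. g a r s)"
      unfolding g_def of_real_sum by (rule sum.swap)
    finally show ?thesis .
  qed
  then have W3: "mat_cumulant M 3 W = diag_matrix (\<lambda>a. (\<Sum>r\<in>I. wishart_third_moment M (S r) (h r) a) + (\<Sum>r\<in>I. \<Sum>s\<in>I. g a r s))"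
    by (simp add: cumulant_3)
  have single: "mat_cumulant M 3 (complex_wishart (S r) (h r)) = diag_matrix (\<lambda>a. wishart_third_moment M (S r) (h r) a + g a r r)"
    if "r \<in> I" for r
    using wishart_family.cumulant_3[OF singleton_family[OF that]]
    by (simp add: wishart_family.mean_def[OF singleton_family[OF that]] g_def)
  have "(\<Sum>r\<in>I. \<Sum>s\<in>I. g a r s) - (\<Sum>r\<in>I. g a r r) = (\<Sum>(r, s)\<in>{(r, s). r \<in> I \<and> s \<in> I \<and> r \<noteq> s}. g a r s)" for a
  proof -
    have "(\<Sum>r\<in>I. \<Sum>s\<in>I. g a r s) - (\<Sum>r\<in>I. g a r r) = (\<Sum>r\<in>I. \<Sum>s\<in>I - {r}. g a r s)"
      using finite_I by (simp add: sum_diff1 flip: sum_subtractf)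
    also have "\<dots> = (\<Sum>(r, s)\<in>Sigma I (\<lambda>r. I - {r}). g a r s)"
      using finite_I by (intro sum.Sigma) auto
    also have "Sigma I (\<lambda>r. I - {r}) = {(r, s). r \<in> I \<and> s \<in> I \<and> r \<noteq> s}"
      by auto
    finally show ?thesis .
  qed
  then show ?thesis
    unfolding g_def[symmetric]
    by (simp add: W3 single vec_eq_iff diag_matrix_entry sum.distrib)
qed

end

section \<open>Comparison with the trace formula\<close>

lemma diagonal_covariance_mult_entry:
  assumes "diagonal_covariance A" "diagonal_covariance B"
  shows "(A ** B) $ i $ j = (if i = j then A $ i $ i * B $ i $ i else 0)"
proof -
  have "(A ** B) $ i $ j = (\<Sum>k\<in>UNIV. if k = i then A $ i $ i * B $ i $ j else 0)"
    unfolding matrix_matrix_mult_def vec_lambda_beta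
    using assms by (intro sum.cong refl) (auto simp: diagonal_covariance_def)
  then show ?thesis
    using assms by (auto simp: diagonal_covariance_def)
qed

theorem theorem1:
  fixes M :: "'a measure" and R :: nat
    and S :: "nat \<Rightarrow> real ^ 'n ^ 'n"
    and h :: "nat \<Rightarrow> 'a \<Rightarrow> complex ^ 'n"
    and Wr :: "nat \<Rightarrow> 'a \<Rightarrow> complex ^ 'n ^ 'n"
    and W :: "'a \<Rightarrow> complex ^ 'n ^ 'n"
    and \<Theta> :: "nat \<Rightarrow> complex ^ 'n ^ 'n"
  assumes "prob_space M" and "R \<ge> 1"
    and "\<And>r. r \<in> {1..R} \<Longrightarrow> diagonal_covariance (S r)"
    and "\<And>r. r \<in> {1..R} \<Longrightarrow> iid_complex_gaussian_vector M (h r)"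
    and "prob_space.indep_vars M (\<lambda>_. borel) h {1..R}"
    and "\<And>r. r \<in> {1..R} \<Longrightarrow> Wr r = complex_wishart (S r) (h r)"
    and "W = (\<lambda>\<omega>. \<Sum>r = 1..R. Wr r \<omega>)"
    and "\<And>n. n \<ge> 1 \<Longrightarrow> mat_cumulant M n W = (\<Sum>r = 1..R. mat_cumulant M n (Wr r)) + \<Theta> n"
  shows "\<Theta> 1 = 0 \<and> \<Theta> 2 = 0 \<and>
    \<Theta> 3 = cmatrix
      ((\<Sum>(i, j) \<in> {(i, j). 1 \<le> i \<and> i < j \<and> j \<le> R}.
          trace (S i ** S j) *\<^sub>R S i - trace (S i) *\<^sub>R (S i ** S j)) +
       (\<Sum>(i, j) \<in> {(i, j). 1 \<le> i \<and> i < j \<and> j \<le> R}.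
          trace (S i ** S j) *\<^sub>R S j - trace (S j) *\<^sub>R (S i ** S j)))"
proof -
  interpret prob_space M by fact
  interpret wishart_family M "{1..R}" S h
    by unfold_locales (use assms in auto)
  have W: "W = (\<lambda>\<omega>. \<Sum>r = 1..R. complex_wishart (S r) (h r) \<omega>)"
    using assms(6,7) by simp
  have \<Theta>: "\<Theta> n = mat_cumulant M n (\<lambda>\<omega>. \<Sum>r = 1..R. complex_wishart (S r) (h r) \<omega>) -
      (\<Sum>r = 1..R. mat_cumulant M n (complex_wishart (S r) (h r)))" if "n \<ge> 1" for n
    using assms(8)[OF that] assms(6) by (simp add: W)
  let ?P = "{(i, j). 1 \<le> i \<and> i < j \<and> j \<le> R}"
  define g where "g a r s = (\<Sum>b\<in>UNIV. (S s $ b $ b - S s $ a $ a) * (S r $ a $ a * S r $ b $ b))" for a r s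
  have fin: "finite ?P"
    by (rule finite_subset[of _ "{1..R} \<times> {1..R}"]) auto
  \<comment> \<open>Ordered pairs of distinct indices are split by which index is smaller; the two
    halves become the two sums of the formula.\<close>
  have pairs: "(\<Sum>(r, s)\<in>{(r, s). r \<in> {1..R} \<and> s \<in> {1..R} \<and> r \<noteq> s}. g a r s) =
      (\<Sum>(i, j)\<in>?P. g a i j) + (\<Sum>(i, j)\<in>?P. g a j i)" for a
  proof -
    have split: "{(r, s). r \<in> {1..R} \<and> s \<in> {1..R} \<and> r \<noteq> s} = ?P \<union> prod.swap ` ?P"
      by (auto simp: image_iff)
    have "(\<Sum>(r, s)\<in>prod.swap ` ?P. g a r s) = (\<Sum>(i, j)\<in>?P. g a j i)"
      by (subst sum.reindex) (auto simp: inj_on_def intro!: sum.cong)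
    then show ?thesis
      unfolding split using fin by (subst sum.union_disjoint) auto
  qed
  define A where "A i j = trace (S i ** S j) *\<^sub>R S i - trace (S i) *\<^sub>R (S i ** S j)" for i j
  define B where "B i j = trace (S i ** S j) *\<^sub>R S j - trace (S j) *\<^sub>R (S i ** S j)" for i j
  have tr: "trace (S i ** S j) = (\<Sum>b\<in>UNIV. S i $ b $ b * S j $ b $ b)" if "(i, j) \<in> ?P" for i j
    using that assms(3) by (simp add: trace_def diagonal_covariance_mult_entry)
  \<comment> \<open>Writing both traces as sums over \<open>b\<close> and factoring out the entry
    (a, a) of \<open>S i\<close> leaves the difference of the entries (b, b) and (a, a) of
    \<open>S j\<close> in each term.\<close>
  have A: "A i j $ a $ b = (if a = b then g a i j else 0)" if "(i, j) \<in> ?P" for i j a b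
    using that assms(3) diagonal[of i] unfolding A_def tr[OF that]
    by (simp add: diagonal_covariance_mult_entry g_def trace_def diagonal_covariance_def
        sum_distrib_left sum_distrib_right algebra_simps flip: sum_subtractf)
  have B: "B i j $ a $ b = (if a = b then g a j i else 0)" if "(i, j) \<in> ?P" for i j a b
    using that assms(3) diagonal[of j] unfolding B_def tr[OF that]
    by (simp add: diagonal_covariance_mult_entry g_def trace_def diagonal_covariance_def
        sum_distrib_left sum_distrib_right algebra_simps flip: sum_subtractf)
  have \<Theta>3: "\<Theta> 3 = diag_matrix (\<lambda>a. \<Sum>(r, s)\<in>{(r, s). r \<in> {1..R} \<and> s \<in> {1..R} \<and> r \<noteq> s}. complex_of_real (g a r s))"
    using \<Theta>[of 3] residual_3 unfolding g_def by simp
  have "\<Theta> 3 = diag_matrix (\<lambda>a. complex_of_real ((\<Sum>(i, j)\<in>?P. g a i j) + (\<Sum>(i, j)\<in>?P. g a j i)))"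
    unfolding \<Theta>3 pairs[symmetric] of_real_sum by (simp only: case_prod_unfold)
  also have "\<dots> = cmatrix ((\<Sum>(i, j)\<in>?P. A i j) + (\<Sum>(i, j)\<in>?P. B i j))"
  proof -
    have "(\<Sum>(i, j)\<in>?P. A i j) $ a $ b = (\<Sum>(i, j)\<in>?P. if a = b then g a i j else 0)"
      "(\<Sum>(i, j)\<in>?P. B i j) $ a $ b = (\<Sum>(i, j)\<in>?P. if a = b then g a j i else 0)" for a b
      unfolding sum_component by (auto intro!: sum.cong simp: A B)
    then show ?thesis
      by (simp add: vec_eq_iff cmatrix_def map_matrix_def diag_matrix_entry)
  qed
  finally show ?thesis
    using \<Theta>[of 1] \<Theta>[of 2] residual_1 residual_2 unfolding A_def B_def by simp
qed

end
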